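(* Let $\mathbb{C}$ be a category with pullbacks, let $(\mathcal{F},\mathfrak{f}):\mathbb{C}^{\mathrm{op}}\to\mathrm{Cat}$ be any pseudofunctor, and let $p:e\to b$ be a morphism of $\mathbb{C}$. If $p$ is of effective $\mathcal{F}$-descent and the functor $\mathcal{F}(p):\mathcal{F}(b)\to\mathcal{F}(e)$ has a left adjoint, then $\mathcal{F}(p)$ is monadic.
   Context: $\mathrm{Cat}$ is the $2$-category of categories in some universe. A right adjoint functor is monadic if its comparison functor to the Eilenberg-Moore category of the induced monad is an equivalence of categories. The category $\Delta_3$: the subcategory of the category of finite nonempty ordinals and order-preserving maps with objects $\mathsf{1},\mathsf{2},\mathsf{3}$ generated by the maps $d^0,d^1:\mathsf{1}\to\mathsf{2}$, $s^0:\mathsf{2}\to\mathsf{1}$, $D^0,D^1,D^2:\mathsf{2}\to\mathsf{3}$ (the usual cofaces, $d^i$ and $D^i$ omitting $i$ from the image, and codegeneracy), subject to $s^0d^1=\mathrm{id}_{\mathsf{1}}=s^0d^0$ and $D^td^k=D^kd^{t-1}$ for $t>k$. A pseudofunctor $(\mathcal{A},\mathfrak{a}):\Delta_3\to\mathrm{Cat}$ has invertible natural transformations $\mathfrak{a}_{hg}:\mathcal{A}(h)\mathcal{A}(g)\Rightarrow\mathcal{A}(hg)$ and $\mathfrak{a}_x:\mathrm{id}_{\mathcal{A}(x)}\Rightarrow\mathcal{A}(\mathrm{id}_x)$ satisfying the usual coherence equations (similarly for pseudofunctors with any category as domain). Put $\mathcal{A}(\sigma_{01})=\mathfrak{a}_{D^0d^0}^{-1}\cdot\mathfrak{a}_{D^1d^0}$,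 $\mathcal{A}(\sigma_{02})=\mathfrak{a}_{D^0d^1}^{-1}\cdot\mathfrak{a}_{D^2d^0}$, $\mathcal{A}(\sigma_{12})=\mathfrak{a}_{D^1d^1}^{-1}\cdot\mathfrak{a}_{D^2d^1}$, $\mathcal{A}(\mathfrak{n}_0)=\mathfrak{a}_{\mathsf{1}}^{-1}\cdot\mathfrak{a}_{s^0d^0}$, $\mathcal{A}(\mathfrak{n}_1)=\mathfrak{a}_{\mathsf{1}}^{-1}\cdot\mathfrak{a}_{s^0d^1}$. Lax descent category $\mathrm{lax}\text{-}\mathrm{Desc}(\mathcal{A})$: objects are pairs $(w,\varphi)$ with $w$ an object of $\mathcal{A}(\mathsf{1})$ and $\varphi:\mathcal{A}(d^1)(w)\to\mathcal{A}(d^0)(w)$ a morphism of $\mathcal{A}(\mathsf{2})$ such that $\mathcal{A}(D^0)(\varphi)\cdot\mathcal{A}(\sigma_{02})_w\cdot\mathcal{A}(D^2)(\varphi)=\mathcal{A}(\sigma_{01})_w\cdot\mathcal{A}(D^1)(\varphi)\cdot\mathcal{A}(\sigma_{12})_w$ and $\mathcal{A}(\mathfrak{n}_0)_w\cdot\mathcal{A}(s^0)(\varphi)=\mathcal{A}(\mathfrak{n}_1)_w$. A morphism $(w,\varphi)\to(w',\varphi')$ is a morphism $m:w\to w'$ of $\mathcal{A}(\mathsf{1})$ with $\mathcal{A}(d^0)(m)\cdot\varphi=\varphi'\cdot\mathcal{A}(d^1)(m)$; composition is that of $\mathcal{A}(\mathsf{1})$. The forgetful functor $\mathsf{d}^{\mathcal{A}}:\mathrm{lax}\text{-}\mathrm{Desc}(\mathcal{A})\to\mathcal{A}(\mathsf{1})$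 sends $(w,\varphi)\mapsto w$ and $m\mapsto m$. Effective descent: for $p:e\to b$ in $\mathbb{C}$, $\mathsf{Eq}(p):\Delta_3^{\mathrm{op}}\to\mathbb{C}$ is the precategory underlying the kernel pair groupoid of $p$: $\mathsf{1}\mapsto e$, $\mathsf{2}\mapsto e\times_be$, $\mathsf{3}\mapsto e\times_be\times_be$, with $d^1\mapsto\pi_e$ and $d^0\mapsto\pi^e$ the two projections $e\times_be\to e$ (first and second, i.e. $d^i$ is sent to the projection omitting component $i$, components numbered from $0$), $s^0$ sent to the diagonal, and $D^i$ sent to the projection $e\times_be\times_be\to e\times_be$ omitting component $i$. Let $\mathcal{F}^p=\mathcal{F}\circ\mathsf{Eq}(p)^{\mathrm{op}}:\Delta_3\to\mathrm{Cat}$ (composite pseudofunctor). Write $\mathfrak{f}_{\pi_e p}:\mathcal{F}(\pi_e)\mathcal{F}(p)\Rightarrow\mathcal{F}(p\circ\pi_e)$ and $\mathfrak{f}_{\pi^e p}:\mathcal{F}(\pi^e)\mathcal{F}(p)\Rightarrow\mathcal{F}(p\circ\pi^e)$ for the structure isomorphisms of $\mathcal{F}$; note $p\circ\pi_e=p\circ\pi^e$. The comparison functor $K_p:\mathcal{F}(b)\to\mathrm{lax}\text{-}\mathrm{Desc}(\mathcal{F}^p)$ sends $x$ to $\big(\mathcal{F}(p)(x),(\mathfrak{f}_{\pi^e p}^{-1}\cdot\mathfrak{f}_{\pi_e p})_x\big)$ and a morphism $u$ to $\mathcal{F}(p)(u)$; it satisfies $\mathsf{d}^{\mathcal{F}^p}\circ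 K_p=\mathcal{F}(p)$. The morphism $p$ is of effective $\mathcal{F}$-descent if $K_p$ is an equivalence of categories. *)

theory Defs
  imports Main
begin

section \<open>Categories, functors, natural transformations\<close>

text \<open>Everything is relativised to the carriers \<open>Obj\<close> and \<open>Arr\<close>; values of the
  operations outside the carriers are irrelevant. The types of objects and of arrows play the
  role of the universe.\<close>

record ('o, 'm) cat =
  Obj :: "'o set"
  Arr :: "'m set"
  Dom :: "'m \<Rightarrow> 'o"
  Cod :: "'m \<Rightarrow> 'o"
  Idn :: "'o \<Rightarrow> 'm"
  Cmp :: "'m \<Rightarrow> 'm \<Rightarrow> 'm"  (infixl "\<cdot>\<index>" 70)

definition hom :: "('o, 'm) cat \<Rightarrow> 'o \<Rightarrow> 'o \<Rightarrow> 'm set" where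
  "hom C x y = {f \<in> Arr C. Dom C f = x \<and> Cod C f = y}"

definition category :: "('o, 'm) cat \<Rightarrow> bool" where
  "category C \<longleftrightarrow>
     (\<forall>f\<in>Arr C. Dom C f \<in> Obj C \<and> Cod C f \<in> Obj C) \<and>
     (\<forall>x\<in>Obj C. Idn C x \<in> hom C x x) \<and>
     (\<forall>f\<in>Arr C. \<forall>g\<in>Arr C. Dom C g = Cod C f \<longrightarrow> g \<cdot>\<^bsub>C\<^esub> f \<in> hom C (Dom C f) (Cod C g)) \<and>
     (\<forall>f\<in>Arr C. Idn C (Cod C f) \<cdot>\<^bsub>C\<^esub> f = f \<and> f \<cdot>\<^bsub>C\<^esub> Idn C (Dom C f) = f) \<and>
     (\<forall>f\<in>Arr C. \<forall>g\<in>Arr C. \<forall>h\<in>Arr C. Dom C g = Cod C f \<and> Dom C h = Cod C g \<longrightarrow>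
        h \<cdot>\<^bsub>C\<^esub> g \<cdot>\<^bsub>C\<^esub> f = h \<cdot>\<^bsub>C\<^esub> (g \<cdot>\<^bsub>C\<^esub> f))"

definition op_cat :: "('o, 'm) cat \<Rightarrow> ('o, 'm) cat" where
  "op_cat C = \<lparr>Obj = Obj C, Arr = Arr C, Dom = Cod C, Cod = Dom C, Idn = Idn C,
     Cmp = (\<lambda>g f. f \<cdot>\<^bsub>C\<^esub> g)\<rparr>"

definition inverse_arrows :: "('o, 'm) cat \<Rightarrow> 'm \<Rightarrow> 'm \<Rightarrow> bool" where
  "inverse_arrows C f g \<longleftrightarrow> f \<in> Arr C \<and> g \<in> hom C (Cod C f) (Dom C f) \<and>
     g \<cdot>\<^bsub>C\<^esub> f = Idn C (Dom C f) \<and> f \<cdot>\<^bsub>C\<^esub> g = Idn C (Cod C f)"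

definition iso :: "('o, 'm) cat \<Rightarrow> 'm \<Rightarrow> bool" where
  "iso C f \<longleftrightarrow> (\<exists>g. inverse_arrows C f g)"

definition inv_arr :: "('o, 'm) cat \<Rightarrow> 'm \<Rightarrow> 'm" where
  "inv_arr C f = (THE g. inverse_arrows C f g)"

record ('o1, 'm1, 'o2, 'm2) func =
  FObj :: "'o1 \<Rightarrow> 'o2"
  FArr :: "'m1 \<Rightarrow> 'm2"

definition is_functor ::
  "('o1, 'm1) cat \<Rightarrow> ('o2, 'm2) cat \<Rightarrow> ('o1, 'm1, 'o2, 'm2) func \<Rightarrow> bool" where
  "is_functor C D F \<longleftrightarrow> category C \<and> category D \<and>
     (\<forall>x\<in>Obj C. FObj F x \<in> Obj D) \<and>
     (\<forall>f\<in>Arr C. FArr F f \<in> hom D (FObj F (Dom C f)) (FObj F (Cod C f))) \<and>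
     (\<forall>x\<in>Obj C. FArr F (Idn C x) = Idn D (FObj F x)) \<and>
     (\<forall>f\<in>Arr C. \<forall>g\<in>Arr C. Dom C g = Cod C f \<longrightarrow>
        FArr F (g \<cdot>\<^bsub>C\<^esub> f) = FArr F g \<cdot>\<^bsub>D\<^esub> FArr F f)"

definition fid :: "('o, 'm, 'o, 'm) func" where
  "fid = \<lparr>FObj = (\<lambda>x. x), FArr = (\<lambda>f. f)\<rparr>"

definition fcomp ::
  "('o2, 'm2, 'o3, 'm3) func \<Rightarrow> ('o1, 'm1, 'o2, 'm2) func \<Rightarrow> ('o1, 'm1, 'o3, 'm3) func"
  (infixl "\<circ>\<^sub>F" 75) where
  "G \<circ>\<^sub>F F = \<lparr>FObj = FObj G \<circ> FObj F, FArr = FArr G \<circ> FArr F\<rparr>"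

definition nat_trans ::
  "('o1, 'm1) cat \<Rightarrow> ('o2, 'm2) cat \<Rightarrow> ('o1, 'm1, 'o2, 'm2) func \<Rightarrow> ('o1, 'm1, 'o2, 'm2) func
    \<Rightarrow> ('o1 \<Rightarrow> 'm2) \<Rightarrow> bool" where
  "nat_trans C D F G \<tau> \<longleftrightarrow> is_functor C D F \<and> is_functor C D G \<and>
     (\<forall>x\<in>Obj C. \<tau> x \<in> hom D (FObj F x) (FObj G x)) \<and>
     (\<forall>f\<in>Arr C. \<tau> (Cod C f) \<cdot>\<^bsub>D\<^esub> FArr F f = FArr G f \<cdot>\<^bsub>D\<^esub> \<tau> (Dom C f))"

definition nat_iso ::
  "('o1, 'm1) cat \<Rightarrow> ('o2, 'm2) cat \<Rightarrow> ('o1, 'm1, 'o2, 'm2) func \<Rightarrow> ('o1, 'm1, 'o2, 'm2) func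
    \<Rightarrow> ('o1 \<Rightarrow> 'm2) \<Rightarrow> bool" where
  "nat_iso C D F G \<tau> \<longleftrightarrow> nat_trans C D F G \<tau> \<and> (\<forall>x\<in>Obj C. iso D (\<tau> x))"

definition equivalence_of_cats ::
  "('o1, 'm1) cat \<Rightarrow> ('o2, 'm2) cat \<Rightarrow> ('o1, 'm1, 'o2, 'm2) func \<Rightarrow> bool" where
  "equivalence_of_cats C D F \<longleftrightarrow> is_functor C D F \<and>
     (\<exists>G \<alpha> \<beta>. is_functor D C G \<and> nat_iso C C fid (G \<circ>\<^sub>F F) \<alpha> \<and> nat_iso D D (F \<circ>\<^sub>F G) fid \<beta>)"

text \<open>Categories whose objects are pairs of an object of \<open>A\<close> and some structure, and whose
  morphisms are the morphisms \<open>m\<close> of \<open>A\<close> compatible with the structures. Source and target are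
  recorded in the arrows, because one \<open>m\<close> can be a morphism between several pairs of objects.\<close>

definition structured_cat ::
  "('o, 'm) cat \<Rightarrow> ('o \<times> 's) set \<Rightarrow> ('o \<times> 's \<Rightarrow> 'm \<Rightarrow> 'o \<times> 's \<Rightarrow> bool)
    \<Rightarrow> ('o \<times> 's, ('o \<times> 's) \<times> 'm \<times> ('o \<times> 's)) cat" where
  "structured_cat A S ok =
     \<lparr>Obj = S,
      Arr = {(X, m, Y). X \<in> S \<and> Y \<in> S \<and> m \<in> hom A (fst X) (fst Y) \<and> ok X m Y},
      Dom = (\<lambda>(X, m, Y). X),
      Cod = (\<lambda>(X, m, Y). Y),
      Idn = (\<lambda>X. (X, Idn A (fst X), X)),
      Cmp = (\<lambda>(Y, n, Z) (X, m, Y'). (X, n \<cdot>\<^bsub>A\<^esub> m, Z))\<rparr>"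


section \<open>Adjunctions and monadicity\<close>

definition adjunction ::
  "('o1, 'm1) cat \<Rightarrow> ('o2, 'm2) cat \<Rightarrow> ('o2, 'm2, 'o1, 'm1) func \<Rightarrow> ('o1, 'm1, 'o2, 'm2) func
    \<Rightarrow> ('o2 \<Rightarrow> 'm2) \<Rightarrow> ('o1 \<Rightarrow> 'm1) \<Rightarrow> bool" where
  "adjunction B A L R \<eta> \<epsilon> \<longleftrightarrow> is_functor A B L \<and> is_functor B A R \<and>
     nat_trans A A fid (R \<circ>\<^sub>F L) \<eta> \<and> nat_trans B B (L \<circ>\<^sub>F R) fid \<epsilon> \<and>
     (\<forall>a\<in>Obj A. \<epsilon> (FObj L a) \<cdot>\<^bsub>B\<^esub> FArr L (\<eta> a) = Idn B (FObj L a)) \<and>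
     (\<forall>b\<in>Obj B. FArr R (\<epsilon> b) \<cdot>\<^bsub>A\<^esub> \<eta> (FObj R b) = Idn A (FObj R b))"

definition has_left_adjoint ::
  "('o1, 'm1) cat \<Rightarrow> ('o2, 'm2) cat \<Rightarrow> ('o1, 'm1, 'o2, 'm2) func \<Rightarrow> bool" where
  "has_left_adjoint B A R \<longleftrightarrow> (\<exists>L \<eta> \<epsilon>. adjunction B A L R \<eta> \<epsilon>)"

definition algebras ::
  "('o, 'm) cat \<Rightarrow> ('o, 'm, 'o, 'm) func \<Rightarrow> ('o \<Rightarrow> 'm) \<Rightarrow> ('o \<Rightarrow> 'm) \<Rightarrow> ('o \<times> 'm) set" where
  "algebras A T \<eta> \<mu> = {(a, h). a \<in> Obj A \<and> h \<in> hom A (FObj T a) a \<and>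
     h \<cdot>\<^bsub>A\<^esub> \<eta> a = Idn A a \<and> h \<cdot>\<^bsub>A\<^esub> \<mu> a = h \<cdot>\<^bsub>A\<^esub> FArr T h}"

definition EM_cat ::
  "('o, 'm) cat \<Rightarrow> ('o, 'm, 'o, 'm) func \<Rightarrow> ('o \<Rightarrow> 'm) \<Rightarrow> ('o \<Rightarrow> 'm)
    \<Rightarrow> ('o \<times> 'm, ('o \<times> 'm) \<times> 'm \<times> ('o \<times> 'm)) cat" where
  "EM_cat A T \<eta> \<mu> = structured_cat A (algebras A T \<eta> \<mu>)
     (\<lambda>(a, h) m (a', h'). m \<cdot>\<^bsub>A\<^esub> h = h' \<cdot>\<^bsub>A\<^esub> FArr T m)"

definition EM_cat_of_adjunction ::
  "('o2, 'm2) cat \<Rightarrow> ('o2, 'm2, 'o1, 'm1) func \<Rightarrow> ('o1, 'm1, 'o2, 'm2) func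
    \<Rightarrow> ('o2 \<Rightarrow> 'm2) \<Rightarrow> ('o1 \<Rightarrow> 'm1) \<Rightarrow> ('o2 \<times> 'm2, ('o2 \<times> 'm2) \<times> 'm2 \<times> ('o2 \<times> 'm2)) cat" where
  "EM_cat_of_adjunction A L R \<eta> \<epsilon> =
     EM_cat A (R \<circ>\<^sub>F L) \<eta> (\<lambda>a. FArr R (\<epsilon> (FObj L a)))"

definition EM_comparison ::
  "('o1, 'm1) cat \<Rightarrow> ('o1, 'm1, 'o2, 'm2) func \<Rightarrow> ('o1 \<Rightarrow> 'm1)
    \<Rightarrow> ('o1, 'm1, 'o2 \<times> 'm2, ('o2 \<times> 'm2) \<times> 'm2 \<times> ('o2 \<times> 'm2)) func" where
  "EM_comparison B R \<epsilon> =
     (let K = (\<lambda>b. (FObj R b, FArr R (\<epsilon> b)))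
      in \<lparr>FObj = K, FArr = (\<lambda>u. (K (Dom B u), FArr R u, K (Cod B u)))\<rparr>)"

text \<open>The comparison functor depends on the chosen left adjoint, unit and counit only up to
  isomorphism; the definition demands an equivalence for every choice.\<close>

definition monadic ::
  "('o1, 'm1) cat \<Rightarrow> ('o2, 'm2) cat \<Rightarrow> ('o1, 'm1, 'o2, 'm2) func \<Rightarrow> bool" where
  "monadic B A R \<longleftrightarrow> has_left_adjoint B A R \<and>
     (\<forall>L \<eta> \<epsilon>. adjunction B A L R \<eta> \<epsilon> \<longrightarrow>
        equivalence_of_cats B (EM_cat_of_adjunction A L R \<eta> \<epsilon>) (EM_comparison B R \<epsilon>))"


section \<open>Pseudofunctors into the 2-category of categories\<close>

text \<open>\<open>PComp \<A> h g\<close> consists of the components of \<open>\<a>\<^sub>h\<^sub>g : \<A>(h)\<A>(g) \<Rightarrow> \<A>(hg)\<close> and \<open>PUnit \<A> x\<close> of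
  those of \<open>\<a>\<^sub>x : id \<Rightarrow> \<A>(id\<^sub>x)\<close>.\<close>

record ('d, 'k, 'o, 'm) pfunc =
  PCat :: "'d \<Rightarrow> ('o, 'm) cat"
  PFun :: "'k \<Rightarrow> ('o, 'm, 'o, 'm) func"
  PComp :: "'k \<Rightarrow> 'k \<Rightarrow> 'o \<Rightarrow> 'm"
  PUnit :: "'d \<Rightarrow> 'o \<Rightarrow> 'm"

definition pseudofunctor :: "('d, 'k) cat \<Rightarrow> ('d, 'k, 'o, 'm) pfunc \<Rightarrow> bool" where
  "pseudofunctor D \<A> \<longleftrightarrow> category D \<and>
     (\<forall>x\<in>Obj D. category (PCat \<A> x)) \<and>
     (\<forall>f\<in>Arr D. is_functor (PCat \<A> (Dom D f)) (PCat \<A> (Cod D f)) (PFun \<A> f)) \<and>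
     (\<forall>g\<in>Arr D. \<forall>h\<in>Arr D. Dom D h = Cod D g \<longrightarrow>
        nat_iso (PCat \<A> (Dom D g)) (PCat \<A> (Cod D h))
          (PFun \<A> h \<circ>\<^sub>F PFun \<A> g) (PFun \<A> (h \<cdot>\<^bsub>D\<^esub> g)) (PComp \<A> h g)) \<and>
     (\<forall>x\<in>Obj D. nat_iso (PCat \<A> x) (PCat \<A> x) fid (PFun \<A> (Idn D x)) (PUnit \<A> x)) \<and>
     (\<forall>f\<in>Arr D. \<forall>g\<in>Arr D. \<forall>h\<in>Arr D. Dom D g = Cod D f \<and> Dom D h = Cod D g \<longrightarrow>
        (\<forall>w\<in>Obj (PCat \<A> (Dom D f)).
           PComp \<A> (h \<cdot>\<^bsub>D\<^esub> g) f w \<cdot>\<^bsub>PCat \<A> (Cod D h)\<^esub> PComp \<A> h g (FObj (PFun \<A> f) w) =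
           PComp \<A> h (g \<cdot>\<^bsub>D\<^esub> f) w \<cdot>\<^bsub>PCat \<A> (Cod D h)\<^esub> FArr (PFun \<A> h) (PComp \<A> g f w))) \<and>
     (\<forall>f\<in>Arr D. \<forall>w\<in>Obj (PCat \<A> (Dom D f)).
        PComp \<A> (Idn D (Cod D f)) f w \<cdot>\<^bsub>PCat \<A> (Cod D f)\<^esub> PUnit \<A> (Cod D f) (FObj (PFun \<A> f) w) =
          Idn (PCat \<A> (Cod D f)) (FObj (PFun \<A> f) w) \<and>
        PComp \<A> f (Idn D (Dom D f)) w \<cdot>\<^bsub>PCat \<A> (Cod D f)\<^esub> FArr (PFun \<A> f) (PUnit \<A> (Dom D f) w) =
          Idn (PCat \<A> (Cod D f)) (FObj (PFun \<A> f) w))"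

definition pf_precomp ::
  "('d2, 'k2, 'o, 'm) pfunc \<Rightarrow> ('d1, 'k1, 'd2, 'k2) func \<Rightarrow> ('d1, 'k1, 'o, 'm) pfunc" where
  "pf_precomp \<F> E = \<lparr>PCat = PCat \<F> \<circ> FObj E, PFun = PFun \<F> \<circ> FArr E,
     PComp = (\<lambda>h g. PComp \<F> (FArr E h) (FArr E g)), PUnit = PUnit \<F> \<circ> FObj E\<rparr>"


section \<open>The category \<open>\<Delta>\<^sub>3\<close>\<close>

text \<open>The triple \<open>(m, n, xs)\<close> stands for the map \<open>{0..<m} \<rightarrow> {0..<n}\<close> with list of values
  \<open>xs\<close>.\<close>

type_synonym ord_map = "nat \<times> nat \<times> nat list"

definition fin_ord_cat :: "(nat, ord_map) cat" where
  "fin_ord_cat = \<lparr>Obj = {n. 0 < n},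
     Arr = {(m, n, xs). 0 < m \<and> 0 < n \<and> length xs = m \<and> set xs \<subseteq> {0..<n} \<and> sorted xs},
     Dom = (\<lambda>(m, n, xs). m),
     Cod = (\<lambda>(m, n, xs). n),
     Idn = (\<lambda>n. (n, n, [0..<n])),
     Cmp = (\<lambda>(n, k, ys) (m, n', xs). (m, k, map (\<lambda>i. ys ! i) xs))\<rparr>"

definition coface :: "nat \<Rightarrow> nat \<Rightarrow> ord_map" where
  "coface n i = (n, n + 1, map (\<lambda>j. if j < i then j else j + 1) [0..<n])"

abbreviation dd :: "nat \<Rightarrow> ord_map" where "dd i \<equiv> coface 1 i"
abbreviation DD :: "nat \<Rightarrow> ord_map" where "DD i \<equiv> coface 2 i"

definition s0 :: ord_map where
  "s0 = (2, 1, [0, 0])"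

inductive_set Delta3_arr :: "ord_map set" where
  "n \<in> {1, 2, 3} \<Longrightarrow> Idn fin_ord_cat n \<in> Delta3_arr"
| "i \<le> 1 \<Longrightarrow> dd i \<in> Delta3_arr"
| "s0 \<in> Delta3_arr"
| "i \<le> 2 \<Longrightarrow> DD i \<in> Delta3_arr"
| "f \<in> Delta3_arr \<Longrightarrow> g \<in> Delta3_arr \<Longrightarrow> Dom fin_ord_cat g = Cod fin_ord_cat f
     \<Longrightarrow> g \<cdot>\<^bsub>fin_ord_cat\<^esub> f \<in> Delta3_arr"

definition Delta3 :: "(nat, ord_map) cat" where
  "Delta3 = fin_ord_cat\<lparr>Obj := {1, 2, 3}, Arr := Delta3_arr\<rparr>"

lemma Delta3_relations:
  "s0 \<cdot>\<^bsub>Delta3\<^esub> dd 1 = Idn Delta3 1"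
  "s0 \<cdot>\<^bsub>Delta3\<^esub> dd 0 = Idn Delta3 1"
  "k < t \<Longrightarrow> t \<le> 2 \<Longrightarrow> DD t \<cdot>\<^bsub>Delta3\<^esub> dd k = DD k \<cdot>\<^bsub>Delta3\<^esub> dd (t - 1)"
  by (auto simp: Delta3_def fin_ord_cat_def coface_def s0_def numeral_2_eq_2)


section \<open>Lax descent categories\<close>

context
  fixes \<A> :: "(nat, ord_map, 'o, 'm) pfunc"
begin

definition sigma01 :: "'o \<Rightarrow> 'm" where
  "sigma01 w = inv_arr (PCat \<A> 3) (PComp \<A> (DD 0) (dd 0) w) \<cdot>\<^bsub>PCat \<A> 3\<^esub> PComp \<A> (DD 1) (dd 0) w"

definition sigma02 :: "'o \<Rightarrow> 'm" where
  "sigma02 w = inv_arr (PCat \<A> 3) (PComp \<A> (DD 0) (dd 1) w) \<cdot>\<^bsub>PCat \<A> 3\<^esub> PComp \<A> (DD 2) (dd 0) w"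

definition sigma12 :: "'o \<Rightarrow> 'm" where
  "sigma12 w = inv_arr (PCat \<A> 3) (PComp \<A> (DD 1) (dd 1) w) \<cdot>\<^bsub>PCat \<A> 3\<^esub> PComp \<A> (DD 2) (dd 1) w"

definition nn0 :: "'o \<Rightarrow> 'm" where
  "nn0 w = inv_arr (PCat \<A> 1) (PUnit \<A> 1 w) \<cdot>\<^bsub>PCat \<A> 1\<^esub> PComp \<A> s0 (dd 0) w"

definition nn1 :: "'o \<Rightarrow> 'm" where
  "nn1 w = inv_arr (PCat \<A> 1) (PUnit \<A> 1 w) \<cdot>\<^bsub>PCat \<A> 1\<^esub> PComp \<A> s0 (dd 1) w"

definition lax_descent_data :: "('o \<times> 'm) set" where
  "lax_descent_data = {(w, \<phi>). w \<in> Obj (PCat \<A> 1) \<and>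
     \<phi> \<in> hom (PCat \<A> 2) (FObj (PFun \<A> (dd 1)) w) (FObj (PFun \<A> (dd 0)) w) \<and>
     FArr (PFun \<A> (DD 0)) \<phi> \<cdot>\<^bsub>PCat \<A> 3\<^esub> sigma02 w \<cdot>\<^bsub>PCat \<A> 3\<^esub> FArr (PFun \<A> (DD 2)) \<phi> =
       sigma01 w \<cdot>\<^bsub>PCat \<A> 3\<^esub> FArr (PFun \<A> (DD 1)) \<phi> \<cdot>\<^bsub>PCat \<A> 3\<^esub> sigma12 w \<and>
     nn0 w \<cdot>\<^bsub>PCat \<A> 1\<^esub> FArr (PFun \<A> s0) \<phi> = nn1 w}"

definition lax_Desc :: "('o \<times> 'm, ('o \<times> 'm) \<times> 'm \<times> ('o \<times> 'm)) cat" where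
  "lax_Desc = structured_cat (PCat \<A> 1) lax_descent_data
     (\<lambda>(w, \<phi>) m (w', \<phi>').
        FArr (PFun \<A> (dd 0)) m \<cdot>\<^bsub>PCat \<A> 2\<^esub> \<phi> = \<phi>' \<cdot>\<^bsub>PCat \<A> 2\<^esub> FArr (PFun \<A> (dd 1)) m)"

end


section \<open>Kernel pairs and effective descent\<close>

definition is_pullback :: "('c, 'k) cat \<Rightarrow> 'k \<Rightarrow> 'k \<Rightarrow> 'k \<Rightarrow> 'k \<Rightarrow> bool" where
  "is_pullback C f g p q \<longleftrightarrow>
     f \<in> Arr C \<and> g \<in> Arr C \<and> p \<in> Arr C \<and> q \<in> Arr C \<and> Cod C f = Cod C g \<and>
     Dom C p = Dom C q \<and> Cod C p = Dom C f \<and> Cod C q = Dom C g \<and> f \<cdot>\<^bsub>C\<^esub> p = g \<cdot>\<^bsub>C\<^esub> q \<and>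
     (\<forall>x\<in>Obj C. \<forall>u\<in>hom C x (Dom C f). \<forall>v\<in>hom C x (Dom C g). f \<cdot>\<^bsub>C\<^esub> u = g \<cdot>\<^bsub>C\<^esub> v \<longrightarrow>
        (\<exists>!t. t \<in> hom C x (Dom C p) \<and> p \<cdot>\<^bsub>C\<^esub> t = u \<and> q \<cdot>\<^bsub>C\<^esub> t = v))"

definition has_pullbacks :: "('c, 'k) cat \<Rightarrow> bool" where
  "has_pullbacks C \<longleftrightarrow>
     (\<forall>f\<in>Arr C. \<forall>g\<in>Arr C. Cod C f = Cod C g \<longrightarrow> (\<exists>p q. is_pullback C f g p q))"

text \<open>\<open>x\<close> is the \<open>n\<close>-fold fibre product of \<open>e = Dom p\<close> over \<open>b = Cod p\<close>, with projections
  \<open>pr 0, \<dots>, pr (n - 1)\<close> to \<open>e\<close>.\<close>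

definition is_fibre_power ::
  "('c, 'k) cat \<Rightarrow> 'k \<Rightarrow> nat \<Rightarrow> 'c \<Rightarrow> (nat \<Rightarrow> 'k) \<Rightarrow> bool" where
  "is_fibre_power C p n x pr \<longleftrightarrow> x \<in> Obj C \<and>
     (\<forall>i<n. pr i \<in> hom C x (Dom C p)) \<and>
     (\<forall>i<n. \<forall>j<n. p \<cdot>\<^bsub>C\<^esub> pr i = p \<cdot>\<^bsub>C\<^esub> pr j) \<and>
     (\<forall>y\<in>Obj C. \<forall>q. (\<forall>i<n. q i \<in> hom C y (Dom C p)) \<and>
        (\<forall>i<n. \<forall>j<n. p \<cdot>\<^bsub>C\<^esub> q i = p \<cdot>\<^bsub>C\<^esub> q j) \<longrightarrow>
        (\<exists>!t. t \<in> hom C y x \<and> (\<forall>i<n. pr i \<cdot>\<^bsub>C\<^esub> t = q i)))"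

text \<open>A choice of \<open>e\<close>, \<open>e \<times>\<^sub>b e\<close> and \<open>e \<times>\<^sub>b e \<times>\<^sub>b e\<close>, where \<open>pr n i\<close> is the projection of
  the \<open>n\<close>-fold product to component \<open>i\<close>.\<close>

definition fibre_powers :: "('c, 'k) cat \<Rightarrow> 'k \<Rightarrow> (nat \<Rightarrow> 'c) \<Rightarrow> (nat \<Rightarrow> nat \<Rightarrow> 'k) \<Rightarrow> bool" where
  "fibre_powers C p P pr \<longleftrightarrow> P 1 = Dom C p \<and> pr 1 0 = Idn C (Dom C p) \<and>
     is_fibre_power C p 2 (P 2) (pr 2) \<and> is_fibre_power C p 3 (P 3) (pr 3)"

text \<open>The functor \<open>Eq(p)\<close> from \<open>op_cat Delta3\<close> to \<open>C\<close>: a map \<open>f\<close> from \<open>m\<close> to \<open>n\<close> goes to the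
  arrow \<open>P n \<rightarrow> P m\<close> whose component \<open>i\<close> is the projection to component \<open>f(i)\<close>. On the
  generators these are the projections and the diagonal, see \<open>Eq_generators\<close> below.\<close>

definition Eq ::
  "('c, 'k) cat \<Rightarrow> (nat \<Rightarrow> 'c) \<Rightarrow> (nat \<Rightarrow> nat \<Rightarrow> 'k) \<Rightarrow> (nat, ord_map, 'c, 'k) func" where
  "Eq C P pr = \<lparr>FObj = P, FArr = (\<lambda>(m, n, xs).
     THE t. t \<in> hom C (P n) (P m) \<and> (\<forall>i<m. pr m i \<cdot>\<^bsub>C\<^esub> t = pr n (xs ! i)))\<rparr>"

text \<open>The composite of \<open>\<F>\<close> with the opposite of \<open>Eq(p)\<close>, a pseudofunctor on \<open>Delta3\<close>. The
  opposite of a functor has the same underlying maps.\<close>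

definition F_p ::
  "('c, 'k) cat \<Rightarrow> ('c, 'k, 'o, 'm) pfunc \<Rightarrow> (nat \<Rightarrow> 'c) \<Rightarrow> (nat \<Rightarrow> nat \<Rightarrow> 'k)
    \<Rightarrow> (nat, ord_map, 'o, 'm) pfunc" where
  "F_p C \<F> P pr = pf_precomp \<F> (Eq C P pr)"

definition descent_comparison ::
  "('c, 'k) cat \<Rightarrow> ('c, 'k, 'o, 'm) pfunc \<Rightarrow> 'k \<Rightarrow> (nat \<Rightarrow> 'c) \<Rightarrow> (nat \<Rightarrow> nat \<Rightarrow> 'k)
    \<Rightarrow> ('o, 'm, 'o \<times> 'm, ('o \<times> 'm) \<times> 'm \<times> ('o \<times> 'm)) func" where
  "descent_comparison C \<F> p P pr =
     (let B = PCat \<F> (Cod C p); E2 = PCat \<F> (P 2);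
          K = (\<lambda>x. (FObj (PFun \<F> p) x,
                     inv_arr E2 (PComp \<F> (pr 2 1) p x) \<cdot>\<^bsub>E2\<^esub> PComp \<F> (pr 2 0) p x))
      in \<lparr>FObj = K, FArr = (\<lambda>u. (K (Dom B u), FArr (PFun \<F> p) u, K (Cod B u)))\<rparr>)"

text \<open>Fibre products are determined only up to isomorphism, and different choices lead to
  isomorphic lax descent categories and comparison functors. The definition asks for some
  choice, so a result assuming effective descent holds for each choice.\<close>

definition effective_descent :: "('c, 'k) cat \<Rightarrow> ('c, 'k, 'o, 'm) pfunc \<Rightarrow> 'k \<Rightarrow> bool" where
  "effective_descent C \<F> p \<longleftrightarrow> (\<exists>P pr. fibre_powers C p P pr \<and>
     equivalence_of_cats (PCat \<F> (Cod C p)) (lax_Desc (F_p C \<F> P pr))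
       (descent_comparison C \<F> p P pr))"


section \<open>Well-definedness of \<open>Eq(p)\<close> and \<open>\<F>\<^sup>p\<close>\<close>

text \<open>Pullbacks provide a choice of fibre powers; \<open>Eq\<close> is a functor with the expected values on
  the generators, and its composite with \<open>\<F>\<close> is a pseudofunctor.\<close>

lemma hom_comp:
  assumes "category C" "f \<in> hom C x y" "g \<in> hom C y z"
  shows "g \<cdot>\<^bsub>C\<^esub> f \<in> hom C x z"
  using assms by (auto simp: category_def hom_def)

lemma hom_assoc:
  assumes "category C" "f \<in> hom C x y" "g \<in> hom C y z" "h \<in> hom C z w"
  shows "h \<cdot>\<^bsub>C\<^esub> g \<cdot>\<^bsub>C\<^esub> f = h \<cdot>\<^bsub>C\<^esub> (g \<cdot>\<^bsub>C\<^esub> f)"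
  using assms unfolding category_def hom_def by auto

lemma hom_idn:
  assumes "category C" "f \<in> hom C x y"
  shows "Idn C y \<cdot>\<^bsub>C\<^esub> f = f" "f \<cdot>\<^bsub>C\<^esub> Idn C x = f" "Idn C x \<in> hom C x x" "Idn C y \<in> hom C y y" "x \<in> Obj C" "y \<in> Obj C"
  using assms unfolding category_def hom_def by auto

lemma is_fibre_power_1:
  assumes "category C" "p \<in> Arr C"
  shows "is_fibre_power C p 1 (Dom C p) (\<lambda>_. Idn C (Dom C p))"
proof -
  have p: "p \<in> hom C (Dom C p) (Cod C p)" using assms by (simp add: hom_def)
  show ?thesis
    unfolding is_fibre_power_def using hom_idn[OF assms(1) p] hom_idn[OF assms(1)] by auto
qed

lemma fibre_powers_all:
  assumes "category C" "p \<in> Arr C" "fibre_powers C p P pr" "n \<in> {1,2,3}"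
  shows "is_fibre_power C p n (P n) (pr n)"
proof -
  have "is_fibre_power C p 1 (P 1) (pr 1)"
    using is_fibre_power_1[OF assms(1,2)] assms(3) by (simp add: is_fibre_power_def fibre_powers_def)
  then show ?thesis using assms by (auto simp: fibre_powers_def)
qed

lemma Delta3_arr_sub:
  "f \<in> Delta3_arr \<Longrightarrow> f \<in> Arr fin_ord_cat \<and> Dom fin_ord_cat f \<in> {1,2,3} \<and> Cod fin_ord_cat f \<in> {1,2,3}"
proof (induction rule: Delta3_arr.induct)
  case (5 f g)
  obtain m n xs where f: "f = (m,n,xs)" by (cases f)
  obtain n' k ys where g: "g = (n',k,ys)" by (cases g)
  have "length xs = m" "set xs \<subseteq> {0..<n}" "sorted xs" "length ys = n" "set ys \<subseteq> {0..<k}" "sorted ys"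
    and mk: "n' = n" "0 < m" "0 < k" "m \<in> {1,2,3}" "k \<in> {1,2,3}"
    using 5 by (auto simp: f g fin_ord_cat_def)
  note xy = this
  have "set (map ((!) ys) xs) \<subseteq> {0..<k}"
  proof
    fix v assume "v \<in> set (map ((!) ys) xs)"
    then obtain i where "i \<in> set xs" "v = ys ! i" by auto
    then have "v \<in> set ys" using xy(2,4) by auto
    then show "v \<in> {0..<k}" using xy(5) by blast
  qed
  moreover have "sorted (map ((!) ys) xs)"
    unfolding sorted_iff_nth_mono
  proof (intro allI impI)
    fix i j assume ij: "i \<le> j" "j < length (map ((!) ys) xs)"
    then have "xs ! i \<le> xs ! j" using xy(3) by (simp add: sorted_iff_nth_mono)
    moreover have "xs ! j < length ys" using ij xy(2,4) nth_mem[of j xs] by (auto simp: subset_iff)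
    ultimately show "map ((!) ys) xs ! i \<le> map ((!) ys) xs ! j"
      using ij xy(6) by (simp add: sorted_iff_nth_mono)
  qed
  ultimately show ?case using mk xy(1) by (simp add: f g fin_ord_cat_def)
qed (auto simp: fin_ord_cat_def coface_def s0_def numeral_2_eq_2 numeral_3_eq_3)

lemma Eq_arr:
  assumes "category C" "p \<in> Arr C" "fibre_powers C p P pr"
    and "(m,n,xs) \<in> Arr fin_ord_cat" "m \<in> {1,2,3}" "n \<in> {1,2,3}"
  shows "\<exists>!t. t \<in> hom C (P n) (P m) \<and> (\<forall>i<m. pr m i \<cdot>\<^bsub>C\<^esub> t = pr n (xs ! i))"
    and "FArr (Eq C P pr) (m,n,xs) \<in> hom C (P n) (P m)"
    and "\<And>i. i < m \<Longrightarrow> pr m i \<cdot>\<^bsub>C\<^esub> FArr (Eq C P pr) (m,n,xs) = pr n (xs ! i)"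
proof -
  have m: "is_fibre_power C p m (P m) (pr m)" and n: "is_fibre_power C p n (P n) (pr n)"
    using fibre_powers_all[OF assms(1-3)] assms(5,6) by simp_all
  have lt: "xs ! i < n" if "i < m" for i
    using assms(4) that by (auto simp: fin_ord_cat_def subset_iff)
  show ex: "\<exists>!t. t \<in> hom C (P n) (P m) \<and> (\<forall>i<m. pr m i \<cdot>\<^bsub>C\<^esub> t = pr n (xs ! i))"
  proof -
    note n' = n[unfolded is_fibre_power_def]
    note pn = n'[THEN conjunct2, THEN conjunct1, rule_format]
      and en = n'[THEN conjunct2, THEN conjunct2, THEN conjunct1, rule_format]
    have "P n \<in> Obj C" by (rule n'[THEN conjunct1])
    moreover have "\<forall>i<m. pr n (xs ! i) \<in> hom C (P n) (Dom C p)" by (intro allI impI pn lt)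
    moreover have "\<forall>i<m. \<forall>j<m. p \<cdot>\<^bsub>C\<^esub> pr n (xs ! i) = p \<cdot>\<^bsub>C\<^esub> pr n (xs ! j)"
      by (intro allI impI en lt)
    ultimately have "P n \<in> Obj C" "\<forall>i<m. pr n (xs ! i) \<in> hom C (P n) (Dom C p)"
      "\<forall>i<m. \<forall>j<m. p \<cdot>\<^bsub>C\<^esub> pr n (xs ! i) = p \<cdot>\<^bsub>C\<^esub> pr n (xs ! j)" .
    note a = this
    show ?thesis
      by (rule m[unfolded is_fibre_power_def, THEN conjunct2, THEN conjunct2, THEN conjunct2,
          THEN bspec, OF a(1), THEN spec, THEN mp, OF conjI[OF a(2,3)]])
  qed
  have E: "FArr (Eq C P pr) (m,n,xs) =
      (THE t. t \<in> hom C (P n) (P m) \<and> (\<forall>i<m. pr m i \<cdot>\<^bsub>C\<^esub> t = pr n (xs ! i)))"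
    by (simp add: Eq_def)
  note T = theI'[OF ex, folded E]
  show "FArr (Eq C P pr) (m,n,xs) \<in> hom C (P n) (P m)" by (rule T[THEN conjunct1])
  show "pr m i \<cdot>\<^bsub>C\<^esub> FArr (Eq C P pr) (m,n,xs) = pr n (xs ! i)" if "i < m" for i
    using T that by blast
qed

lemma Eq_eqI:
  assumes "category C" "p \<in> Arr C" "fibre_powers C p P pr"
    and "(m,n,xs) \<in> Arr fin_ord_cat" "m \<in> {1,2,3}" "n \<in> {1,2,3}"
    and "t \<in> hom C (P n) (P m)" "\<And>i. i < m \<Longrightarrow> pr m i \<cdot>\<^bsub>C\<^esub> t = pr n (xs ! i)"
  shows "FArr (Eq C P pr) (m,n,xs) = t"
  using Eq_arr[OF assms(1-6)] assms(7,8) by blast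

lemma pr_hom:
  assumes "category C" "p \<in> Arr C" "fibre_powers C p P pr" "n \<in> {1,2,3}" "i < n"
  shows "pr n i \<in> hom C (P n) (P 1)"
  using fibre_powers_all[OF assms(1-4)] assms by (auto simp: is_fibre_power_def fibre_powers_def)

lemma Eq_generators:
  assumes "category C" "p \<in> Arr C" "fibre_powers C p P pr"
  shows "FArr (Eq C P pr) (dd 1) = pr 2 0"
    and "FArr (Eq C P pr) (dd 0) = pr 2 1"
    and "\<forall>i<2. pr 2 i \<cdot>\<^bsub>C\<^esub> FArr (Eq C P pr) s0 = Idn C (Dom C p)"
    and "i \<le> 2 \<Longrightarrow> j < 2 \<Longrightarrow>
      pr 2 j \<cdot>\<^bsub>C\<^esub> FArr (Eq C P pr) (DD i) = pr 3 (if j < i then j else j + 1)"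
proof -
  have id1: "pr 1 0 = Idn C (P 1)" "P 1 = Dom C p" using assms by (auto simp: fibre_powers_def)
  have h: "pr 2 0 \<in> hom C (P 2) (P 1)" "pr 2 1 \<in> hom C (P 2) (P 1)"
    using pr_hom[OF assms] by auto
  have "FArr (Eq C P pr) (1, 2, [0]) = pr 2 0"
    by (rule Eq_eqI[OF assms]) (use h hom_idn[OF assms(1) h(1)] id1 in \<open>auto simp: fin_ord_cat_def\<close>)
  then show "FArr (Eq C P pr) (dd 1) = pr 2 0" by (simp add: coface_def numeral_2_eq_2)
  have "FArr (Eq C P pr) (1, 2, [1]) = pr 2 1"
    by (rule Eq_eqI[OF assms]) (use h hom_idn[OF assms(1) h(2)] id1 in \<open>auto simp: fin_ord_cat_def\<close>)
  then show "FArr (Eq C P pr) (dd 0) = pr 2 1" by (simp add: coface_def numeral_2_eq_2)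
  show "\<forall>i<2. pr 2 i \<cdot>\<^bsub>C\<^esub> FArr (Eq C P pr) s0 = Idn C (Dom C p)"
    using Eq_arr(3)[OF assms, of 2 1 "[0,0]"] id1
    by (auto simp: s0_def fin_ord_cat_def less_2_cases_iff)
  assume "i \<le> 2" "j < 2"
  then show "pr 2 j \<cdot>\<^bsub>C\<^esub> FArr (Eq C P pr) (DD i) = pr 3 (if j < i then j else j + 1)"
    using Eq_arr(3)[OF assms, of 2 3 "map (\<lambda>j. if j < i then j else j + 1) [0..<2]" j]
    by (auto simp: coface_def fin_ord_cat_def upt_rec less_2_cases_iff split: if_splits)
qed

lemma category_Delta3: "category Delta3"
proof -
  have *: "f \<in> Delta3_arr \<Longrightarrow> f \<in> Arr fin_ord_cat" for f using Delta3_arr_sub by blast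
  have 1: "\<forall>f\<in>Arr Delta3. Dom Delta3 f \<in> Obj Delta3 \<and> Cod Delta3 f \<in> Obj Delta3"
    using Delta3_arr_sub by (simp add: Delta3_def)
  have 2: "\<forall>x\<in>Obj Delta3. Idn Delta3 x \<in> hom Delta3 x x"
    using Delta3_arr.intros(1) by (auto simp: Delta3_def hom_def fin_ord_cat_def)
  have 3: "\<forall>f\<in>Arr Delta3. \<forall>g\<in>Arr Delta3. Dom Delta3 g = Cod Delta3 f \<longrightarrow> g \<cdot>\<^bsub>Delta3\<^esub> f \<in> hom Delta3 (Dom Delta3 f) (Cod Delta3 g)"
    using Delta3_arr.intros(5) by (auto simp: Delta3_def hom_def fin_ord_cat_def)
  have 4: "\<forall>f\<in>Arr Delta3. Idn Delta3 (Cod Delta3 f) \<cdot>\<^bsub>Delta3\<^esub> f = f \<and> f \<cdot>\<^bsub>Delta3\<^esub> Idn Delta3 (Dom Delta3 f) = f"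
  proof
    fix f assume "f \<in> Arr Delta3"
    then have "f \<in> Arr fin_ord_cat" using * by (simp add: Delta3_def)
    then show "Idn Delta3 (Cod Delta3 f) \<cdot>\<^bsub>Delta3\<^esub> f = f \<and> f \<cdot>\<^bsub>Delta3\<^esub> Idn Delta3 (Dom Delta3 f) = f"
      by (cases f) (auto simp: Delta3_def fin_ord_cat_def subset_iff map_nth intro!: map_idI)
  qed
  have 5: "\<forall>f\<in>Arr Delta3. \<forall>g\<in>Arr Delta3. \<forall>h\<in>Arr Delta3. Dom Delta3 g = Cod Delta3 f \<and> Dom Delta3 h = Cod Delta3 g \<longrightarrow>
        h \<cdot>\<^bsub>Delta3\<^esub> g \<cdot>\<^bsub>Delta3\<^esub> f = h \<cdot>\<^bsub>Delta3\<^esub> (g \<cdot>\<^bsub>Delta3\<^esub> f)"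
  proof (intro ballI impI)
    fix f g h assume "f \<in> Arr Delta3" "g \<in> Arr Delta3" "h \<in> Arr Delta3"
      and e: "Dom Delta3 g = Cod Delta3 f \<and> Dom Delta3 h = Cod Delta3 g"
    then have "f \<in> Arr fin_ord_cat" "g \<in> Arr fin_ord_cat" using * by (auto simp: Delta3_def)
    then show "h \<cdot>\<^bsub>Delta3\<^esub> g \<cdot>\<^bsub>Delta3\<^esub> f = h \<cdot>\<^bsub>Delta3\<^esub> (g \<cdot>\<^bsub>Delta3\<^esub> f)"
      using e by (cases f; cases g; cases h) (auto simp: Delta3_def fin_ord_cat_def subset_iff)
  qed
  show ?thesis unfolding category_def using 1 2 3 4 5 by blast
qed

lemma category_op: "category C \<Longrightarrow> category (op_cat C)"
  unfolding category_def op_cat_def hom_def by auto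

lemma Eq_functor:
  assumes "category C" "p \<in> Arr C" "fibre_powers C p P pr"
  shows "is_functor (op_cat Delta3) C (Eq C P pr)"
proof -
  have PO: "P n \<in> Obj C" if "n \<in> {1,2,3}" for n
    using fibre_powers_all[OF assms that] by (simp add: is_fibre_power_def)
  have comp: "FArr (Eq C P pr) (f \<cdot>\<^bsub>Delta3\<^esub> g) = FArr (Eq C P pr) g \<cdot>\<^bsub>C\<^esub> FArr (Eq C P pr) f"
    if "f \<in> Delta3_arr" "g \<in> Delta3_arr" "Dom fin_ord_cat f = Cod fin_ord_cat g" for f g
  proof -
    obtain m n xs where g: "g = (m,n,xs)" by (cases g)
    obtain n' k ys where f0: "f = (n',k,ys)" by (cases f)
    then have f: "f = (n,k,ys)" using that g by (simp add: fin_ord_cat_def)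
    have mnk: "m \<in> {1,2,3}" "n \<in> {1,2,3}" "k \<in> {1,2,3}"
      using Delta3_arr_sub that unfolding f g fin_ord_cat_def by force+
    have A: "(m,n,xs) \<in> Arr fin_ord_cat" "(n,k,ys) \<in> Arr fin_ord_cat"
      "(m,k,map ((!) ys) xs) \<in> Arr fin_ord_cat"
      using Delta3_arr_sub[OF that(1)] Delta3_arr_sub[OF that(2)]
        Delta3_arr_sub[OF Delta3_arr.intros(5)[OF that(2,1,3)]] unfolding f g by (auto simp: fin_ord_cat_def)
    have l: "length xs = m" "\<And>i. i < m \<Longrightarrow> xs ! i < n"
      using A(1) by (auto simp: fin_ord_cat_def subset_iff)
    note G = Eq_arr[OF assms A(1) mnk(1,2)] and F = Eq_arr[OF assms A(2) mnk(2,3)]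
    have "FArr (Eq C P pr) (m,k,map ((!) ys) xs) = FArr (Eq C P pr) g \<cdot>\<^bsub>C\<^esub> FArr (Eq C P pr) f"
    proof (rule Eq_eqI[OF assms A(3) mnk(1,3)])
      show "FArr (Eq C P pr) g \<cdot>\<^bsub>C\<^esub> FArr (Eq C P pr) f \<in> hom C (P k) (P m)"
        using hom_comp[OF assms(1) F(2) G(2)] f g by simp
      fix i assume i: "i < m"
      have "pr m i \<cdot>\<^bsub>C\<^esub> (FArr (Eq C P pr) g \<cdot>\<^bsub>C\<^esub> FArr (Eq C P pr) f) = pr n (xs!i) \<cdot>\<^bsub>C\<^esub> FArr (Eq C P pr) f"
        using hom_assoc[OF assms(1) F(2) G(2) pr_hom[OF assms mnk(1) i]] G(3)[OF i] f g by simp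
      then show "pr m i \<cdot>\<^bsub>C\<^esub> (FArr (Eq C P pr) g \<cdot>\<^bsub>C\<^esub> FArr (Eq C P pr) f) = pr k (map ((!) ys) xs ! i)"
        using F(3)[OF l(2)[OF i]] f l i by simp
    qed
    then show ?thesis by (simp add: f g Delta3_def fin_ord_cat_def)
  qed
  have idn: "FArr (Eq C P pr) (n,n,[0..<n]) = Idn C (P n)" if "n \<in> {1,2,3}" for n
  proof (rule Eq_eqI[OF assms])
    show "Idn C (P n) \<in> hom C (P n) (P n)" using PO[OF that] assms(1) by (simp add: category_def)
    show "pr n i \<cdot>\<^bsub>C\<^esub> Idn C (P n) = pr n ([0..<n] ! i)" if i: "i < n" for i
      using hom_idn(2)[OF assms(1) pr_hom[OF assms \<open>n \<in> {1,2,3}\<close> i]] i by simp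
  qed (use that in \<open>auto simp: fin_ord_cat_def\<close>)
  have hm: "FArr (Eq C P pr) f \<in> hom C (P (Cod fin_ord_cat f)) (P (Dom fin_ord_cat f))"
    if "f \<in> Delta3_arr" for f
    using Delta3_arr_sub[OF that] Eq_arr(2)[OF assms] by (cases f) (auto simp: fin_ord_cat_def)
  have FO: "FObj (Eq C P pr) = P" by (simp add: Eq_def)
  show ?thesis unfolding is_functor_def FO
    using category_op[OF category_Delta3] assms(1) PO hm comp idn
    by (auto simp: op_cat_def Delta3_def fin_ord_cat_def)
qed

lemma ex_fibre_powers:
  assumes "category C" "has_pullbacks C" "p \<in> Arr C"
  shows "\<exists>P pr. fibre_powers C p P pr"
proof -
  let ?e = "Dom C p"
  have p: "p \<in> hom C ?e (Cod C p)" using assms by (simp add: hom_def)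
  obtain u v where uv: "is_pullback C p p u v" using assms unfolding has_pullbacks_def by blast
  let ?P = "Dom C u"
  have h: "u \<in> hom C ?P ?e" "v \<in> hom C ?P ?e" "p \<cdot>\<^bsub>C\<^esub> u = p \<cdot>\<^bsub>C\<^esub> v"
    using uv by (auto simp: is_pullback_def hom_def)
  have U: "\<exists>!t. t \<in> hom C y ?P \<and> u \<cdot>\<^bsub>C\<^esub> t = a \<and> v \<cdot>\<^bsub>C\<^esub> t = b"
    if "y \<in> Obj C" "a \<in> hom C y ?e" "b \<in> hom C y ?e" "p \<cdot>\<^bsub>C\<^esub> a = p \<cdot>\<^bsub>C\<^esub> b" for y a b
    using uv that unfolding is_pullback_def by blast
  have O: "?P \<in> Obj C" using hom_idn[OF assms(1) h(1)] by simp
  have 2: "is_fibre_power C p 2 ?P (\<lambda>i. if i = 0 then u else v)"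
  proof -
    have "\<exists>!t. t \<in> hom C y ?P \<and> (\<forall>i<2. (if i = 0 then u else v) \<cdot>\<^bsub>C\<^esub> t = q i)"
      if "y \<in> Obj C" "\<forall>i<2. q i \<in> hom C y ?e" "\<forall>i<2. \<forall>j<2. p \<cdot>\<^bsub>C\<^esub> q i = p \<cdot>\<^bsub>C\<^esub> q j" for y and q :: "nat \<Rightarrow> _"
    proof -
      have "(\<forall>i<2. (if i = 0 then u else v) \<cdot>\<^bsub>C\<^esub> t = q i) \<longleftrightarrow> u \<cdot>\<^bsub>C\<^esub> t = q 0 \<and> v \<cdot>\<^bsub>C\<^esub> t = q 1" for t
        by (auto simp: less_2_cases_iff)
      note E = this
      have q: "q 0 \<in> hom C y ?e" "q 1 \<in> hom C y ?e" using that(2) by simp_all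
      have pq: "p \<cdot>\<^bsub>C\<^esub> q 0 = p \<cdot>\<^bsub>C\<^esub> q 1" by (rule that(3)[rule_format]; simp)
      from U[OF that(1) q pq] show ?thesis unfolding E .
    qed
    note U2 = this
    have "\<forall>i<2::nat. (if i = 0 then u else v) \<in> hom C ?P ?e"
      "\<forall>i<2::nat. \<forall>j<2::nat. p \<cdot>\<^bsub>C\<^esub> (if i = 0 then u else v) = p \<cdot>\<^bsub>C\<^esub> (if j = 0 then u else v)"
      using h by auto
    then show ?thesis unfolding is_fibre_power_def
      by (intro conjI ballI allI impI O) (use U2 in blast)+
  qed
  obtain r s where rs: "is_pullback C v u r s" 
  proof -
    have "v \<in> Arr C" "u \<in> Arr C" "Cod C v = Cod C u" using h by (auto simp: hom_def)
    then show ?thesis using assms(2) that unfolding has_pullbacks_def by blast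
  qed
  let ?Q = "Dom C r"
  have k: "r \<in> hom C ?Q ?P" "s \<in> hom C ?Q ?P" "v \<cdot>\<^bsub>C\<^esub> r = u \<cdot>\<^bsub>C\<^esub> s"
    using rs h by (auto simp: is_pullback_def hom_def)
  have V: "\<exists>!t. t \<in> hom C y ?Q \<and> r \<cdot>\<^bsub>C\<^esub> t = a \<and> s \<cdot>\<^bsub>C\<^esub> t = b"
    if "y \<in> Obj C" "a \<in> hom C y ?P" "b \<in> hom C y ?P" "v \<cdot>\<^bsub>C\<^esub> a = u \<cdot>\<^bsub>C\<^esub> b" for y a b
  proof -
    have D: "Dom C v = ?P" using h by (auto simp: hom_def)
    have "\<forall>x\<in>Obj C. \<forall>a\<in>hom C x ?P. \<forall>b\<in>hom C x ?P. v \<cdot>\<^bsub>C\<^esub> a = u \<cdot>\<^bsub>C\<^esub> b \<longrightarrow>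
        (\<exists>!t. t \<in> hom C x ?Q \<and> r \<cdot>\<^bsub>C\<^esub> t = a \<and> s \<cdot>\<^bsub>C\<^esub> t = b)"
      using rs unfolding is_pullback_def D by (elim conjE)
    from this[rule_format, OF that] show ?thesis .
  qed
  let ?pr = "\<lambda>i::nat. if i = 0 then u \<cdot>\<^bsub>C\<^esub> r else if i = 1 then v \<cdot>\<^bsub>C\<^esub> r else v \<cdot>\<^bsub>C\<^esub> s"
  have lt3: "i < 3 \<longleftrightarrow> i = 0 \<or> i = 1 \<or> i = 2" for i :: nat by auto
  have eqs: "p \<cdot>\<^bsub>C\<^esub> (u \<cdot>\<^bsub>C\<^esub> r) = p \<cdot>\<^bsub>C\<^esub> (v \<cdot>\<^bsub>C\<^esub> r)" "p \<cdot>\<^bsub>C\<^esub> (u \<cdot>\<^bsub>C\<^esub> s) = p \<cdot>\<^bsub>C\<^esub> (v \<cdot>\<^bsub>C\<^esub> s)"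
    unfolding hom_assoc[OF assms(1) k(1) h(1) p, symmetric] hom_assoc[OF assms(1) k(1) h(2) p, symmetric]
      hom_assoc[OF assms(1) k(2) h(1) p, symmetric] hom_assoc[OF assms(1) k(2) h(2) p, symmetric] h(3) by (rule refl)+
  have 3: "is_fibre_power C p 3 ?Q ?pr"
  proof -
    have "\<exists>!t. t \<in> hom C y ?Q \<and> (\<forall>i<3. ?pr i \<cdot>\<^bsub>C\<^esub> t = q i)"
      if y: "y \<in> Obj C" and q: "\<forall>i<3. q i \<in> hom C y ?e" and pq: "\<forall>i<3. \<forall>j<3. p \<cdot>\<^bsub>C\<^esub> q i = p \<cdot>\<^bsub>C\<^esub> q j" for y and q :: "nat \<Rightarrow> _"
    proof -
      have q': "q 0 \<in> hom C y ?e" "q 1 \<in> hom C y ?e" "q 2 \<in> hom C y ?e"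
         "p \<cdot>\<^bsub>C\<^esub> q 0 = p \<cdot>\<^bsub>C\<^esub> q 1" "p \<cdot>\<^bsub>C\<^esub> q 1 = p \<cdot>\<^bsub>C\<^esub> q 2"
        by (simp_all add: q, (rule pq[rule_format]; simp)+)
      obtain a where a: "a \<in> hom C y ?P" "u \<cdot>\<^bsub>C\<^esub> a = q 0" "v \<cdot>\<^bsub>C\<^esub> a = q 1"
        using U[OF y q'(1,2,4)] by blast
      obtain b where b: "b \<in> hom C y ?P" "u \<cdot>\<^bsub>C\<^esub> b = q 1" "v \<cdot>\<^bsub>C\<^esub> b = q 2"
        using U[OF y q'(2,3,5)] by blast
      have ua: "a' = a" if "a' \<in> hom C y ?P" "u \<cdot>\<^bsub>C\<^esub> a' = q 0" "v \<cdot>\<^bsub>C\<^esub> a' = q 1" for a'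
        using U[OF y q'(1,2,4)] a that by blast
      have ub: "b' = b" if "b' \<in> hom C y ?P" "u \<cdot>\<^bsub>C\<^esub> b' = q 1" "v \<cdot>\<^bsub>C\<^esub> b' = q 2" for b'
        using U[OF y q'(2,3,5)] b that by blast
      have "(\<forall>i<3. ?pr i \<cdot>\<^bsub>C\<^esub> t = q i) \<longleftrightarrow> r \<cdot>\<^bsub>C\<^esub> t = a \<and> s \<cdot>\<^bsub>C\<^esub> t = b" if t: "t \<in> hom C y ?Q" for t
      proof -
        note A = hom_assoc[OF assms(1) t k(1) h(1)] hom_assoc[OF assms(1) t k(1) h(2)]
          hom_assoc[OF assms(1) t k(2) h(1)] hom_assoc[OF assms(1) t k(2) h(2)]
          hom_comp[OF assms(1) t k(1)] hom_comp[OF assms(1) t k(2)]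
        have "(\<forall>i<3. ?pr i \<cdot>\<^bsub>C\<^esub> t = q i) \<longleftrightarrow> u \<cdot>\<^bsub>C\<^esub> r \<cdot>\<^bsub>C\<^esub> t = q 0 \<and> v \<cdot>\<^bsub>C\<^esub> r \<cdot>\<^bsub>C\<^esub> t = q 1 \<and> v \<cdot>\<^bsub>C\<^esub> s \<cdot>\<^bsub>C\<^esub> t = q 2"
          by (auto simp: lt3)
        also have "\<dots> \<longleftrightarrow> r \<cdot>\<^bsub>C\<^esub> t = a \<and> s \<cdot>\<^bsub>C\<^esub> t = b"
        proof
          assume H: "u \<cdot>\<^bsub>C\<^esub> r \<cdot>\<^bsub>C\<^esub> t = q 0 \<and> v \<cdot>\<^bsub>C\<^esub> r \<cdot>\<^bsub>C\<^esub> t = q 1 \<and> v \<cdot>\<^bsub>C\<^esub> s \<cdot>\<^bsub>C\<^esub> t = q 2"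
          have 1: "u \<cdot>\<^bsub>C\<^esub> (s \<cdot>\<^bsub>C\<^esub> t) = q 1"
            unfolding A(3)[symmetric] k(3)[symmetric] using H by (elim conjE)
          have 2: "u \<cdot>\<^bsub>C\<^esub> (r \<cdot>\<^bsub>C\<^esub> t) = q 0" unfolding A(1)[symmetric] using H by (elim conjE)
          have 3: "v \<cdot>\<^bsub>C\<^esub> (r \<cdot>\<^bsub>C\<^esub> t) = q 1" unfolding A(2)[symmetric] using H by (elim conjE)
          have 4: "v \<cdot>\<^bsub>C\<^esub> (s \<cdot>\<^bsub>C\<^esub> t) = q 2" unfolding A(4)[symmetric] using H by (elim conjE)
          show "r \<cdot>\<^bsub>C\<^esub> t = a \<and> s \<cdot>\<^bsub>C\<^esub> t = b"
            by (intro conjI ua[OF A(5) 2 3] ub[OF A(6) 1 4])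
        next
          assume H: "r \<cdot>\<^bsub>C\<^esub> t = a \<and> s \<cdot>\<^bsub>C\<^esub> t = b"
          show "u \<cdot>\<^bsub>C\<^esub> r \<cdot>\<^bsub>C\<^esub> t = q 0 \<and> v \<cdot>\<^bsub>C\<^esub> r \<cdot>\<^bsub>C\<^esub> t = q 1 \<and> v \<cdot>\<^bsub>C\<^esub> s \<cdot>\<^bsub>C\<^esub> t = q 2"
            unfolding A(1) A(2) A(4) conjunct1[OF H] conjunct2[OF H] a b by simp
        qed
        finally show ?thesis .
      qed
      then have "(t \<in> hom C y ?Q \<and> (\<forall>i<3. ?pr i \<cdot>\<^bsub>C\<^esub> t = q i)) \<longleftrightarrow> (t \<in> hom C y ?Q \<and> r \<cdot>\<^bsub>C\<^esub> t = a \<and> s \<cdot>\<^bsub>C\<^esub> t = b)" for t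
        by blast
      note E = this
      have "v \<cdot>\<^bsub>C\<^esub> a = u \<cdot>\<^bsub>C\<^esub> b" unfolding a b by (rule refl)
      from V[OF y a(1) b(1) this] show ?thesis unfolding E .
    qed
    note W = this
    have Q: "?Q \<in> Obj C" using hom_idn[OF assms(1) k(1)] by blast
    have X: "\<forall>i<3::nat. ?pr i \<in> hom C ?Q ?e"
      using hom_comp[OF assms(1) k(1) h(1)] hom_comp[OF assms(1) k(1) h(2)] hom_comp[OF assms(1) k(2) h(2)] by auto
    have "p \<cdot>\<^bsub>C\<^esub> ?pr i = p \<cdot>\<^bsub>C\<^esub> (v \<cdot>\<^bsub>C\<^esub> r)" for i
      using eqs[unfolded k(3)] k(3) by simp
    then have Y: "\<forall>i<3::nat. \<forall>j<3::nat. p \<cdot>\<^bsub>C\<^esub> ?pr i = p \<cdot>\<^bsub>C\<^esub> ?pr j" by metis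
    show ?thesis unfolding is_fibre_power_def
    proof (intro conjI ballI allI impI)
      show "?Q \<in> Obj C" by (rule Q)
    next
      fix i :: nat assume "i < 3" then show "?pr i \<in> hom C ?Q ?e" using X by blast
    next
      fix i j :: nat assume "i < 3" "j < 3"
      then show "p \<cdot>\<^bsub>C\<^esub> ?pr i = p \<cdot>\<^bsub>C\<^esub> ?pr j" using Y by blast
    next
      fix y q assume "y \<in> Obj C" "(\<forall>i<3::nat. q i \<in> hom C y ?e) \<and> (\<forall>i<3. \<forall>j<3. p \<cdot>\<^bsub>C\<^esub> q i = p \<cdot>\<^bsub>C\<^esub> q j)"
      then show "\<exists>!t. t \<in> hom C y ?Q \<and> (\<forall>i<3. ?pr i \<cdot>\<^bsub>C\<^esub> t = q i)"
        using W[of y q] by (elim conjE)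
    qed
  qed
  have "fibre_powers C p (\<lambda>n. if n = 1 then ?e else if n = 2 then ?P else ?Q)
     (\<lambda>n. if n = 1 then (\<lambda>_. Idn C ?e) else if n = 2 then (\<lambda>i. if i = 0 then u else v) else ?pr)"
    using 2 3 by (simp add: fibre_powers_def)
  then show ?thesis by blast
qed

lemma pseudofunctor_precomp:
  assumes "is_functor D' D E" "pseudofunctor D F"
  shows "pseudofunctor D' (pf_precomp F E)"
proof -
  note E = assms(1)[unfolded is_functor_def]
  note F = assms(2)[unfolded pseudofunctor_def]
  have A: "FArr E f \<in> Arr D" "Dom D (FArr E f) = FObj E (Dom D' f)" "Cod D (FArr E f) = FObj E (Cod D' f)"
     "Dom D' f \<in> Obj D'" "Cod D' f \<in> Obj D'"
    if "f \<in> Arr D'" for f using E that by (auto simp: hom_def category_def)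
  have O: "FObj E x \<in> Obj D" "FArr E (Idn D' x) = Idn D (FObj E x)" if "x \<in> Obj D'" for x using E that by blast+
  have M: "FArr E (g \<cdot>\<^bsub>D'\<^esub> f) = FArr E g \<cdot>\<^bsub>D\<^esub> FArr E f"
    if "f \<in> Arr D'" "g \<in> Arr D'" "Dom D' g = Cod D' f" for f g using E that by blast
  show ?thesis unfolding pseudofunctor_def pf_precomp_def
    apply (simp add: A O M cong: ball_cong)
    apply (intro conjI ballI impI allI)
    subgoal using E by blast
    subgoal using F O by blast
    subgoal for f using F A[of f] by metis
    subgoal for g h using F A[of g] A[of h] M[of g h] by metis
    subgoal using F O by metis
    subgoal premises prems for f g h w
    proof -
      have "Dom D' h = Cod D' g" "Dom D' g = Cod D' f" using prems by auto
      then have "Dom D (FArr E g) = Cod D (FArr E f) \<and> Dom D (FArr E h) = Cod D (FArr E g)"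
        using A prems by simp
      then have "\<forall>w\<in>Obj (PCat F (Dom D (FArr E f))).
           PComp F (FArr E h \<cdot>\<^bsub>D\<^esub> FArr E g) (FArr E f) w \<cdot>\<^bsub>PCat F (Cod D (FArr E h))\<^esub> PComp F (FArr E h) (FArr E g) (FObj (PFun F (FArr E f)) w) =
           PComp F (FArr E h) (FArr E g \<cdot>\<^bsub>D\<^esub> FArr E f) w \<cdot>\<^bsub>PCat F (Cod D (FArr E h))\<^esub> FArr (PFun F (FArr E h)) (PComp F (FArr E g) (FArr E f) w)"
        using F A(1) prems by blast
      then show ?thesis using A M prems \<open>Dom D' h = Cod D' g\<close> \<open>Dom D' g = Cod D' f\<close> by simp
    qed
    subgoal premises prems for f w
    proof -
      have "\<forall>w\<in>Obj (PCat F (Dom D (FArr E f))).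
        PComp F (Idn D (Cod D (FArr E f))) (FArr E f) w \<cdot>\<^bsub>PCat F (Cod D (FArr E f))\<^esub> PUnit F (Cod D (FArr E f)) (FObj (PFun F (FArr E f)) w) =
          Idn (PCat F (Cod D (FArr E f))) (FObj (PFun F (FArr E f)) w) \<and>
        PComp F (FArr E f) (Idn D (Dom D (FArr E f))) w \<cdot>\<^bsub>PCat F (Cod D (FArr E f))\<^esub> FArr (PFun F (FArr E f)) (PUnit F (Dom D (FArr E f)) w) =
          Idn (PCat F (Cod D (FArr E f))) (FObj (PFun F (FArr E f)) w)"
        using F A(1) prems by blast
      then show ?thesis using A O prems by simp
    qed
    subgoal premises prems for f w
    proof -
      have "\<forall>w\<in>Obj (PCat F (Dom D (FArr E f))).
        PComp F (Idn D (Cod D (FArr E f))) (FArr E f) w \<cdot>\<^bsub>PCat F (Cod D (FArr E f))\<^esub> PUnit F (Cod D (FArr E f)) (FObj (PFun F (FArr E f)) w) =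
          Idn (PCat F (Cod D (FArr E f))) (FObj (PFun F (FArr E f)) w) \<and>
        PComp F (FArr E f) (Idn D (Dom D (FArr E f))) w \<cdot>\<^bsub>PCat F (Cod D (FArr E f))\<^esub> FArr (PFun F (FArr E f)) (PUnit F (Dom D (FArr E f)) w) =
          Idn (PCat F (Cod D (FArr E f))) (FObj (PFun F (FArr E f)) w)"
        using F A(1) prems by blast
      then show ?thesis using A O prems by simp
    qed
    done
qed

lemma F_p_pseudofunctor:
  assumes "category C" "p \<in> Arr C" "fibre_powers C p P pr" "pseudofunctor (op_cat C) \<F>"
  shows "pseudofunctor Delta3 (F_p C \<F> P pr)"
proof -
  have "is_functor Delta3 (op_cat C) (Eq C P pr)"
  proof -
    let ?E = "Eq C P pr"
    note E = Eq_functor[OF assms(1-3), unfolded is_functor_def]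
    have "\<forall>x\<in>Obj Delta3. FObj ?E x \<in> Obj C" using E by (simp add: op_cat_def)
    moreover have "\<forall>f\<in>Arr Delta3. FArr ?E f \<in> hom C (FObj ?E (Cod Delta3 f)) (FObj ?E (Dom Delta3 f))"
      using E by (simp add: op_cat_def)
    moreover have "\<forall>x\<in>Obj Delta3. FArr ?E (Idn Delta3 x) = Idn C (FObj ?E x)"
      using E by (simp add: op_cat_def)
    moreover have "FArr ?E (g \<cdot>\<^bsub>Delta3\<^esub> f) = FArr ?E f \<cdot>\<^bsub>C\<^esub> FArr ?E g"
      if "f \<in> Arr Delta3" "g \<in> Arr Delta3" "Dom Delta3 g = Cod Delta3 f" for f g
      using E that by (simp add: op_cat_def)
    ultimately show ?thesis unfolding is_functor_def
      using category_Delta3 category_op[OF assms(1)] by (auto simp: op_cat_def hom_def)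
  qed
  then show ?thesis unfolding F_p_def using assms(4) by (rule pseudofunctor_precomp)
qed

end

theory Submission
  imports Defs
begin

text \<open>An object of the lax descent category consists of an object \<open>w\<close> of \<open>\<A>(1)\<close> and an arrow
  \<open>\<phi> : \<A>(d\<^sup>1)(w) \<rightarrow> \<A>(d\<^sup>0)(w)\<close>, and arrows are the arrows of \<open>\<A>(1)\<close> that commute with these. So
  the category is a full subcategory of the inserter of the two functors \<open>P = \<A>(d\<^sup>1)\<close> and
  \<open>Q = \<A>(d\<^sup>0)\<close>. Effective descent says that \<open>R = \<F>(p)\<close> is, up to an equivalence, the
  forgetful functor of such a category. Forgetful functors of lax descent categories create
  absolute colimits, which by Beck's criterion makes \<open>R\<close> monadic as soon as it has a left adjoint
  \<open>L\<close>. The only absolute colimits that matter are the split coequalizers presenting the algebras,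
  and for these the argument unwinds into explicit computations. Write \<open>\<theta>\<^sub>x : P R x \<rightarrow> Q R x\<close> for
  the structure carried by \<open>R x\<close>; it is natural in \<open>x\<close>.

  The comparison functor \<open>b \<mapsto> (R b, R \<epsilon>\<^sub>b)\<close> into the category of algebras is faithful because
  \<open>R\<close> is. It is full because an algebra morphism \<open>m : R b \<rightarrow> R b'\<close> commutes with \<open>\<theta>\<close> after
  precomposition with \<open>P R \<epsilon>\<^sub>b\<close>, which is split by \<open>P \<eta>\<close> and can be cancelled; effective descent
  then provides the preimage of \<open>m\<close> (\<open>algebra_morphism_lift\<close>).

  For essential surjectivity, let \<open>h : R L a \<rightarrow> a\<close> be an algebra. As \<open>h\<close> is a split epimorphism,
  \<open>a\<close> carries at most one structure \<open>\<psi>\<close> that \<open>h\<close> preserves, and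
  \<open>\<psi> = Q h \<cdot> \<theta>\<^bsub>L a\<^esub> \<cdot> P \<eta>\<^sub>a\<close> is one (\<open>algebra_structure_preserving\<close>). The pair \<open>(a, \<psi>)\<close> satisfies
  the cocycle and the unit condition, because both sides of either equation are natural in the
  descent datum and agree on \<open>(R L a, \<theta>\<^bsub>L a\<^esub>)\<close> (\<open>lax_descent_data_split_quotient\<close>). By effective
  descent there is an isomorphism \<open>i : R b \<rightarrow> a\<close> of descent data, and \<open>i\<^sup>-\<^sup>1 \<cdot> h\<close> is the image under
  \<open>R\<close> of an arrow \<open>v : L a \<rightarrow> b\<close>. The arrow \<open>v \<cdot> L i\<close> has the transpose \<open>i\<^sup>-\<^sup>1 \<cdot> h \<cdot> \<eta>\<^sub>a \<cdot> i = id\<close>, so it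
  is the counit \<open>\<epsilon>\<^sub>b\<close>, and therefore \<open>i\<close> is an isomorphism of algebras from \<open>(R b, R \<epsilon>\<^sub>b)\<close> to
  \<open>(a, h)\<close> (\<open>EM_comparison_essentially_surjective\<close>).\<close>

section \<open>Rewriting rules for arrows, functors and transformations\<close>

lemma homI: "f \<in> Arr C \<Longrightarrow> Dom C f = x \<Longrightarrow> Cod C f = y \<Longrightarrow> f \<in> hom C x y"
  by (simp add: hom_def)

lemma homD:
  assumes "f \<in> hom C x y"
  shows "f \<in> Arr C" "Dom C f = x" "Cod C f = y"
  using assms by (simp_all add: hom_def)

text \<open>The rules are phrased with \<open>Dom\<close> and \<open>Cod\<close> instead of \<open>hom\<close>, so that every variable
  of a condition occurs in the term to be rewritten, and rewriting alone decides whether a composite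
  is well typed.\<close>

lemma category_simps:
  assumes "category C"
  shows "f \<in> Arr C \<Longrightarrow> Dom C f \<in> Obj C"
    and "f \<in> Arr C \<Longrightarrow> Cod C f \<in> Obj C"
    and "x \<in> Obj C \<Longrightarrow> Idn C x \<in> Arr C"
    and "x \<in> Obj C \<Longrightarrow> Dom C (Idn C x) = x"
    and "x \<in> Obj C \<Longrightarrow> Cod C (Idn C x) = x"
    and "f \<in> Arr C \<Longrightarrow> g \<in> Arr C \<Longrightarrow> Dom C g = Cod C f \<Longrightarrow> g \<cdot>\<^bsub>C\<^esub> f \<in> Arr C"
    and "f \<in> Arr C \<Longrightarrow> g \<in> Arr C \<Longrightarrow> Dom C g = Cod C f \<Longrightarrow> Dom C (g \<cdot>\<^bsub>C\<^esub> f) = Dom C f"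
    and "f \<in> Arr C \<Longrightarrow> g \<in> Arr C \<Longrightarrow> Dom C g = Cod C f \<Longrightarrow> Cod C (g \<cdot>\<^bsub>C\<^esub> f) = Cod C g"
    and "f \<in> Arr C \<Longrightarrow> Cod C f = y \<Longrightarrow> Idn C y \<cdot>\<^bsub>C\<^esub> f = f"
    and "f \<in> Arr C \<Longrightarrow> Dom C f = x \<Longrightarrow> f \<cdot>\<^bsub>C\<^esub> Idn C x = f"
    and "f \<in> Arr C \<Longrightarrow> g \<in> Arr C \<Longrightarrow> h \<in> Arr C \<Longrightarrow> Dom C g = Cod C f \<Longrightarrow> Dom C h = Cod C g \<Longrightarrow>
      h \<cdot>\<^bsub>C\<^esub> g \<cdot>\<^bsub>C\<^esub> f = h \<cdot>\<^bsub>C\<^esub> (g \<cdot>\<^bsub>C\<^esub> f)"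
  using assms unfolding category_def hom_def by auto

lemma functor_simps:
  assumes "is_functor C D F"
  shows "x \<in> Obj C \<Longrightarrow> FObj F x \<in> Obj D"
    and "f \<in> Arr C \<Longrightarrow> FArr F f \<in> Arr D"
    and "f \<in> Arr C \<Longrightarrow> Dom D (FArr F f) = FObj F (Dom C f)"
    and "f \<in> Arr C \<Longrightarrow> Cod D (FArr F f) = FObj F (Cod C f)"
    and "x \<in> Obj C \<Longrightarrow> FArr F (Idn C x) = Idn D (FObj F x)"
    and "f \<in> Arr C \<Longrightarrow> g \<in> Arr C \<Longrightarrow> Dom C g = Cod C f \<Longrightarrow>
      FArr F (g \<cdot>\<^bsub>C\<^esub> f) = FArr F g \<cdot>\<^bsub>D\<^esub> FArr F f"
  using assms unfolding is_functor_def hom_def by auto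

lemma functor_categories:
  assumes "is_functor C D F"
  shows "category C" "category D"
  using assms by (simp_all add: is_functor_def)

lemma functor_hom: "is_functor C D F \<Longrightarrow> f \<in> hom C x y \<Longrightarrow> FArr F f \<in> hom D (FObj F x) (FObj F y)"
  by (auto simp: is_functor_def hom_def)

lemma nat_trans_simps:
  assumes "nat_trans C D F G \<tau>"
  shows "x \<in> Obj C \<Longrightarrow> \<tau> x \<in> Arr D"
    and "x \<in> Obj C \<Longrightarrow> Dom D (\<tau> x) = FObj F x"
    and "x \<in> Obj C \<Longrightarrow> Cod D (\<tau> x) = FObj G x"
  using assms by (simp_all add: nat_trans_def hom_def)

lemma nat_trans_natural:
  assumes "nat_trans C D F G \<tau>" "f \<in> hom C x y"
  shows "\<tau> y \<cdot>\<^bsub>D\<^esub> FArr F f = FArr G f \<cdot>\<^bsub>D\<^esub> \<tau> x"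
  using assms by (auto simp: nat_trans_def hom_def)

lemma is_functor_fid: "category C \<Longrightarrow> is_functor C C fid"
  by (auto simp: is_functor_def fid_def hom_def)

lemma is_functor_fcomp:
  assumes "is_functor C D F" "is_functor D E G"
  shows "is_functor C E (G \<circ>\<^sub>F F)"
  using assms functor_categories[OF assms(1)] functor_categories[OF assms(2)]
  unfolding is_functor_def[of C E] fcomp_def
  by (auto simp: functor_simps[OF assms(1)] functor_simps[OF assms(2)] category_simps intro!: homI)

lemma isoE:
  assumes "iso C f" "f \<in> hom C x y"
  obtains g where "g \<in> hom C y x" "g \<cdot>\<^bsub>C\<^esub> f = Idn C x" "f \<cdot>\<^bsub>C\<^esub> g = Idn C y"
  using assms by (auto simp: iso_def inverse_arrows_def hom_def)

lemma isoI:
  assumes "f \<in> hom C x y" "g \<in> hom C y x" "g \<cdot>\<^bsub>C\<^esub> f = Idn C x" "f \<cdot>\<^bsub>C\<^esub> g = Idn C y"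
  shows "iso C f"
  using assms by (auto simp: iso_def inverse_arrows_def hom_def)

lemma split_epi_cancel:
  assumes "category C" "h \<in> hom C x y" "s \<in> hom C y x" "h \<cdot>\<^bsub>C\<^esub> s = Idn C y"
    and "f \<in> hom C y z" "g \<in> hom C y z" "f \<cdot>\<^bsub>C\<^esub> h = g \<cdot>\<^bsub>C\<^esub> h"
  shows "f = g"
proof -
  have "f \<cdot>\<^bsub>C\<^esub> h \<cdot>\<^bsub>C\<^esub> s = g \<cdot>\<^bsub>C\<^esub> h \<cdot>\<^bsub>C\<^esub> s" using assms by simp
  then show ?thesis
    using homD[OF assms(2)] homD[OF assms(3)] homD[OF assms(5)] homD[OF assms(6)] assms(4)
    by (simp add: category_simps[OF assms(1)])
qed

lemma split_mono_cancel:
  assumes "category C" "h \<in> hom C x y" "s \<in> hom C y x" "s \<cdot>\<^bsub>C\<^esub> h = Idn C x"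
    and "f \<in> hom C z x" "g \<in> hom C z x" "h \<cdot>\<^bsub>C\<^esub> f = h \<cdot>\<^bsub>C\<^esub> g"
  shows "f = g"
proof -
  have "s \<cdot>\<^bsub>C\<^esub> (h \<cdot>\<^bsub>C\<^esub> f) = s \<cdot>\<^bsub>C\<^esub> (h \<cdot>\<^bsub>C\<^esub> g)" using assms by simp
  then have "s \<cdot>\<^bsub>C\<^esub> h \<cdot>\<^bsub>C\<^esub> f = s \<cdot>\<^bsub>C\<^esub> h \<cdot>\<^bsub>C\<^esub> g"
    using homD[OF assms(2)] homD[OF assms(3)] homD[OF assms(5)] homD[OF assms(6)]
    by (simp add: category_simps[OF assms(1)])
  then show ?thesis
    using homD[OF assms(5)] homD[OF assms(6)] assms(4) by (simp add: category_simps[OF assms(1)])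
qed


section \<open>Equivalences are the fully faithful, essentially surjective functors\<close>

definition fully_faithful ::
  "('o1, 'm1) cat \<Rightarrow> ('o2, 'm2) cat \<Rightarrow> ('o1, 'm1, 'o2, 'm2) func \<Rightarrow> bool" where
  "fully_faithful C D F \<longleftrightarrow> (\<forall>x\<in>Obj C. \<forall>y\<in>Obj C. \<forall>g\<in>hom D (FObj F x) (FObj F y).
     \<exists>!f. f \<in> hom C x y \<and> FArr F f = g)"

definition essentially_surjective ::
  "('o1, 'm1) cat \<Rightarrow> ('o2, 'm2) cat \<Rightarrow> ('o1, 'm1, 'o2, 'm2) func \<Rightarrow> bool" where
  "essentially_surjective C D F \<longleftrightarrow>
     (\<forall>y\<in>Obj D. \<exists>x\<in>Obj C. \<exists>f\<in>hom D (FObj F x) y. iso D f)"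

lemma fully_faithful_full:
  assumes "fully_faithful C D F" "x \<in> Obj C" "y \<in> Obj C" "g \<in> hom D (FObj F x) (FObj F y)"
  shows "\<exists>f\<in>hom C x y. FArr F f = g"
  using assms unfolding fully_faithful_def by blast

lemma fully_faithful_faithful:
  assumes "fully_faithful C D F" "is_functor C D F"
    and f: "f \<in> hom C x y" and "f' \<in> hom C x y" and "FArr F f = FArr F f'"
  shows "f = f'"
proof -
  note xy = hom_idn(5,6)[OF functor_categories(1)[OF assms(2)] f]
  have "\<exists>!h. h \<in> hom C x y \<and> FArr F h = FArr F f"
    using assms(1) xy functor_hom[OF assms(2) f] unfolding fully_faithful_def by blast
  then show ?thesis using assms by metis
qed

text \<open>By naturality \<open>\<alpha>\<^sub>y \<cdot> f = G(F(f)) \<cdot> \<alpha>\<^sub>x\<close>, and \<open>\<alpha>\<^sub>y\<close> is a monomorphism.\<close>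

lemma faithful_of_iso_to_identity:
  assumes F: "is_functor C D F" and G: "is_functor D C G"
    and \<alpha>: "nat_iso C C fid (G \<circ>\<^sub>F F) \<alpha>"
    and f: "f \<in> hom C x y" and g: "g \<in> hom C x y" and eq: "FArr F f = FArr F g"
  shows "f = g"
proof -
  note cC = functor_categories(1)[OF F]
  have n: "nat_trans C C fid (G \<circ>\<^sub>F F) \<alpha>" using \<alpha> by (simp add: nat_iso_def)
  have y: "y \<in> Obj C" using hom_idn[OF cC f] by simp
  have ah: "\<alpha> y \<in> hom C y (FObj G (FObj F y))" using n y by (simp add: nat_trans_def fid_def fcomp_def)
  have ai: "iso C (\<alpha> y)" using \<alpha> y by (simp add: nat_iso_def)
  obtain a where a: "a \<in> hom C (FObj G (FObj F y)) y" "a \<cdot>\<^bsub>C\<^esub> \<alpha> y = Idn C y"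
    using isoE[OF ai ah] by blast
  show ?thesis
  proof (rule split_mono_cancel[OF cC ah a f g])
    show "\<alpha> y \<cdot>\<^bsub>C\<^esub> f = \<alpha> y \<cdot>\<^bsub>C\<^esub> g"
      using nat_trans_natural[OF n f] nat_trans_natural[OF n g] eq by (simp add: fid_def fcomp_def)
  qed
qed

lemma faithful_of_iso_from_identity:
  assumes F: "is_functor C D F" and G: "is_functor D C G"
    and \<beta>: "nat_iso D D (F \<circ>\<^sub>F G) fid \<beta>"
    and f: "f \<in> hom D x y" and g: "g \<in> hom D x y" and eq: "FArr G f = FArr G g"
  shows "f = g"
proof -
  note cD = functor_categories(2)[OF F]
  have n: "nat_trans D D (F \<circ>\<^sub>F G) fid \<beta>" using \<beta> by (simp add: nat_iso_def)
  have x: "x \<in> Obj D" using hom_idn[OF cD f] by simp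
  have bh: "\<beta> x \<in> hom D (FObj F (FObj G x)) x" using n x by (simp add: nat_trans_def fid_def fcomp_def)
  have bi: "iso D (\<beta> x)" using \<beta> x by (simp add: nat_iso_def)
  obtain b where b: "b \<in> hom D x (FObj F (FObj G x))" "\<beta> x \<cdot>\<^bsub>D\<^esub> b = Idn D x"
    using isoE[OF bi bh] by blast
  show ?thesis
  proof (rule split_epi_cancel[OF cD bh b f g])
    show "f \<cdot>\<^bsub>D\<^esub> \<beta> x = g \<cdot>\<^bsub>D\<^esub> \<beta> x"
      using nat_trans_natural[OF n f] nat_trans_natural[OF n g] eq by (simp add: fid_def fcomp_def)
  qed
qed

text \<open>The preimage of \<open>g : F x \<rightarrow> F y\<close> is \<open>\<alpha>\<^sub>y\<^sup>-\<^sup>1 \<cdot> G g \<cdot> \<alpha>\<^sub>x\<close>: its image under \<open>F\<close> and \<open>g\<close> have the same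
  image under \<open>G\<close>, which is faithful by naturality of \<open>\<beta>\<close>.\<close>

lemma equivalence_fully_faithful:
  assumes "equivalence_of_cats C D F"
  shows "fully_faithful C D F"
  unfolding fully_faithful_def
proof (intro ballI)
  fix x y g assume x: "x \<in> Obj C" and y: "y \<in> Obj C" and g: "g \<in> hom D (FObj F x) (FObj F y)"
  obtain G \<alpha> \<beta> where F: "is_functor C D F" and G: "is_functor D C G"
    and \<alpha>: "nat_iso C C fid (G \<circ>\<^sub>F F) \<alpha>" and \<beta>: "nat_iso D D (F \<circ>\<^sub>F G) fid \<beta>"
    using assms unfolding equivalence_of_cats_def by blast
  note cC = functor_categories(1)[OF F]
  have n: "nat_trans C C fid (G \<circ>\<^sub>F F) \<alpha>" using \<alpha> by (simp add: nat_iso_def)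
  have ah: "\<alpha> z \<in> hom C z (FObj G (FObj F z))" "iso C (\<alpha> z)" if "z \<in> Obj C" for z
    using n \<alpha> that by (simp_all add: nat_trans_def fid_def fcomp_def nat_iso_def)
  obtain a where a: "a \<in> hom C (FObj G (FObj F y)) y" "a \<cdot>\<^bsub>C\<^esub> \<alpha> y = Idn C y"
      "\<alpha> y \<cdot>\<^bsub>C\<^esub> a = Idn C (FObj G (FObj F y))"
    using isoE[OF ah(2,1)[OF y]] by blast
  obtain c where c: "c \<in> hom C (FObj G (FObj F x)) x" "\<alpha> x \<cdot>\<^bsub>C\<^esub> c = Idn C (FObj G (FObj F x))"
    using isoE[OF ah(2,1)[OF x]] by blast
  note Gg = functor_hom[OF G g]
  let ?f = "a \<cdot>\<^bsub>C\<^esub> (FArr G g \<cdot>\<^bsub>C\<^esub> \<alpha> x)"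
  note ga = hom_comp[OF cC ah(1)[OF x] Gg]
  have f: "?f \<in> hom C x y" by (rule hom_comp[OF cC ga a(1)])
  note Ff = functor_hom[OF F f]
  have "FArr G (FArr F ?f) = FArr G g"
  proof (rule split_epi_cancel[OF cC ah(1)[OF x] c functor_hom[OF G Ff] Gg])
    have "FArr G (FArr F ?f) \<cdot>\<^bsub>C\<^esub> \<alpha> x = \<alpha> y \<cdot>\<^bsub>C\<^esub> ?f"
      using nat_trans_natural[OF n f] by (simp add: fid_def fcomp_def)
    also have "\<dots> = \<alpha> y \<cdot>\<^bsub>C\<^esub> a \<cdot>\<^bsub>C\<^esub> (FArr G g \<cdot>\<^bsub>C\<^esub> \<alpha> x)"
      by (rule hom_assoc[OF cC ga a(1) ah(1)[OF y], symmetric])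
    also have "\<dots> = FArr G g \<cdot>\<^bsub>C\<^esub> \<alpha> x"
      unfolding a(3) by (rule hom_idn(1)[OF cC ga])
    finally show "FArr G (FArr F ?f) \<cdot>\<^bsub>C\<^esub> \<alpha> x = FArr G g \<cdot>\<^bsub>C\<^esub> \<alpha> x" .
  qed
  then have "FArr F ?f = g" by (rule faithful_of_iso_from_identity[OF F G \<beta> Ff g])
  moreover have "f1 = f2" if "f1 \<in> hom C x y" "f2 \<in> hom C x y" "FArr F f1 = FArr F f2" for f1 f2
    using faithful_of_iso_to_identity[OF F G \<alpha>] that by blast
  ultimately show "\<exists>!f. f \<in> hom C x y \<and> FArr F f = g" using f by metis
qed

lemma equivalence_essentially_surjective:
  assumes "equivalence_of_cats C D F"
  shows "essentially_surjective C D F"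
  unfolding essentially_surjective_def
proof
  fix y assume y: "y \<in> Obj D"
  obtain G \<beta> where G: "is_functor D C G" and \<beta>: "nat_iso D D (F \<circ>\<^sub>F G) fid \<beta>"
    using assms unfolding equivalence_of_cats_def by blast
  have "\<beta> y \<in> hom D (FObj F (FObj G y)) y" "iso D (\<beta> y)"
    using \<beta> y by (simp_all add: nat_iso_def nat_trans_def fid_def fcomp_def)
  then show "\<exists>x\<in>Obj C. \<exists>f\<in>hom D (FObj F x) y. iso D f"
    using functor_simps(1)[OF G y] by blast
qed

text \<open>Choose for each \<open>y\<close> an isomorphism \<open>b\<^sub>y : F (G y) \<rightarrow> y\<close>. Conjugation with the chosen isomorphisms
  and unique preimages under \<open>F\<close> determine \<open>G\<close> on arrows and the unit, and since \<open>F\<close> is faithful all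
  equations may be checked after applying \<open>F\<close>.\<close>

lemma equivalenceI:
  assumes F: "is_functor C D F" and ff: "fully_faithful C D F" and es: "essentially_surjective C D F"
  shows "equivalence_of_cats C D F"
proof -
  note cC = functor_categories(1)[OF F] and cD = functor_categories(2)[OF F]
  note C = category_simps[OF cC] and D = category_simps[OF cD] and FS = functor_simps[OF F]
  have "\<exists>x b c. x \<in> Obj C \<and> b \<in> hom D (FObj F x) y \<and> c \<in> hom D y (FObj F x) \<and>
      c \<cdot>\<^bsub>D\<^esub> b = Idn D (FObj F x) \<and> b \<cdot>\<^bsub>D\<^esub> c = Idn D y" if "y \<in> Obj D" for y
    using es that unfolding essentially_surjective_def by (metis isoE)
  then obtain G0 b c where
      "\<And>y. y \<in> Obj D \<Longrightarrow> G0 y \<in> Obj C \<and> b y \<in> hom D (FObj F (G0 y)) y \<and> c y \<in> hom D y (FObj F (G0 y)) \<and>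
      c y \<cdot>\<^bsub>D\<^esub> b y = Idn D (FObj F (G0 y)) \<and> b y \<cdot>\<^bsub>D\<^esub> c y = Idn D y"
    by metis
  then have G0: "G0 y \<in> Obj C" and b: "b y \<in> hom D (FObj F (G0 y)) y" and c: "c y \<in> hom D y (FObj F (G0 y))"
    and cb: "c y \<cdot>\<^bsub>D\<^esub> b y = Idn D (FObj F (G0 y))" and bc: "b y \<cdot>\<^bsub>D\<^esub> c y = Idn D y"
    if "y \<in> Obj D" for y using that by blast+
  note B = homD[OF b] and CC = homD[OF c]
  have bc': "b y \<cdot>\<^bsub>D\<^esub> (c y \<cdot>\<^bsub>D\<^esub> g) = g" if "g \<in> Arr D" "Cod D g = y" for g y
  proof -
    have y: "y \<in> Obj D" using that D by auto
    have "b y \<cdot>\<^bsub>D\<^esub> (c y \<cdot>\<^bsub>D\<^esub> g) = b y \<cdot>\<^bsub>D\<^esub> c y \<cdot>\<^bsub>D\<^esub> g" using B[OF y] CC[OF y] that D by simp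
    then show ?thesis using bc[OF y] that D by simp
  qed
  have cb': "c y \<cdot>\<^bsub>D\<^esub> (b y \<cdot>\<^bsub>D\<^esub> g) = g" if "y \<in> Obj D" "g \<in> Arr D" "Cod D g = FObj F (G0 y)" for g y
  proof -
    have "c y \<cdot>\<^bsub>D\<^esub> (b y \<cdot>\<^bsub>D\<^esub> g) = c y \<cdot>\<^bsub>D\<^esub> b y \<cdot>\<^bsub>D\<^esub> g" using B[OF that(1)] CC[OF that(1)] that D by simp
    then show ?thesis using cb[OF that(1)] that D by simp
  qed
  define lift where "lift x y g = (THE f. f \<in> hom C x y \<and> FArr F f = g)" for x y g
  have lift: "lift x y g \<in> hom C x y" "FArr F (lift x y g) = g"
    if "x \<in> Obj C" "y \<in> Obj C" "g \<in> hom D (FObj F x) (FObj F y)" for x y g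
    using theI'[of "\<lambda>f. f \<in> hom C x y \<and> FArr F f = g"] ff that
    unfolding fully_faithful_def lift_def by blast+
  note faithful = fully_faithful_faithful[OF ff F]
  define G1 where "G1 g = lift (G0 (Dom D g)) (G0 (Cod D g)) (c (Cod D g) \<cdot>\<^bsub>D\<^esub> (g \<cdot>\<^bsub>D\<^esub> b (Dom D g)))" for g
  have G1: "G1 g \<in> hom C (G0 (Dom D g)) (G0 (Cod D g))"
     "FArr F (G1 g) = c (Cod D g) \<cdot>\<^bsub>D\<^esub> (g \<cdot>\<^bsub>D\<^esub> b (Dom D g))" if "g \<in> Arr D" for g
    unfolding G1_def using that D B CC G0 by (intro lift homI; simp)+
  note G1D = homD[OF G1(1)]
  let ?G = "\<lparr>FObj = G0, FArr = G1\<rparr>"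
  have G: "is_functor D C ?G"
    unfolding is_functor_def
  proof (intro conjI ballI impI)
    fix x assume x: "x \<in> Obj D"
    have "G1 (Idn D x) = Idn C (G0 x)"
      by (rule faithful[of _ "G0 x" "G0 x"])
        (use x G1 D B CC C G0 cb FS in \<open>auto intro!: homI simp: G1D\<close>)
    then show "FArr ?G (Idn D x) = Idn C (FObj ?G x)" by simp
  next
    fix f g assume f: "f \<in> Arr D" and g: "g \<in> Arr D" and e: "Dom D g = Cod D f"
    have "G1 (g \<cdot>\<^bsub>D\<^esub> f) = G1 g \<cdot>\<^bsub>C\<^esub> G1 f"
      by (rule faithful[of _ "G0 (Dom D f)" "G0 (Cod D g)"])
        (use f g e G1 D B CC C G0 FS bc' in \<open>auto intro!: homI simp: G1D\<close>)
    then show "FArr ?G (g \<cdot>\<^bsub>D\<^esub> f) = FArr ?G g \<cdot>\<^bsub>C\<^esub> FArr ?G f" by simp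
  qed (use cC cD G0 G1 in auto)
  define \<alpha> where "\<alpha> x = lift x (G0 (FObj F x)) (c (FObj F x))" for x
  have \<alpha>: "\<alpha> x \<in> hom C x (G0 (FObj F x))" "FArr F (\<alpha> x) = c (FObj F x)" if "x \<in> Obj C" for x
    unfolding \<alpha>_def using that c FS G0 by (intro lift; simp)+
  have \<alpha>_iso: "iso C (\<alpha> x)" if x: "x \<in> Obj C" for x
  proof -
    note Fx = FS(1)[OF x]
    note l = lift[OF G0[OF Fx] x b[OF Fx]]
    show ?thesis
    proof (rule isoI[OF \<alpha>(1)[OF x] l(1)])
      show "lift (G0 (FObj F x)) x (b (FObj F x)) \<cdot>\<^bsub>C\<^esub> \<alpha> x = Idn C x"
        by (rule faithful[of _ x x])
          (use l homD[OF l(1)] \<alpha>[OF x] homD[OF \<alpha>(1)[OF x]] x C FS bc[OF Fx] in \<open>auto intro!: homI\<close>)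
      show "\<alpha> x \<cdot>\<^bsub>C\<^esub> lift (G0 (FObj F x)) x (b (FObj F x)) = Idn C (G0 (FObj F x))"
        by (rule faithful[of _ "G0 (FObj F x)" "G0 (FObj F x)"])
          (use l homD[OF l(1)] \<alpha>[OF x] homD[OF \<alpha>(1)[OF x]] x C FS cb[OF Fx] G0[OF Fx] in \<open>auto intro!: homI\<close>)
    qed
  qed
  have "nat_iso C C fid (?G \<circ>\<^sub>F F) \<alpha>"
    unfolding nat_iso_def nat_trans_def
  proof (intro conjI ballI is_functor_fid[OF cC] is_functor_fcomp[OF F G])
    fix f assume f: "f \<in> Arr C"
    have ob: "Dom C f \<in> Obj C" "Cod C f \<in> Obj C" using C f by auto
    note a = \<alpha>[OF ob(1)] homD[OF \<alpha>(1)[OF ob(1)]] \<alpha>[OF ob(2)] homD[OF \<alpha>(1)[OF ob(2)]]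
    have "\<alpha> (Cod C f) \<cdot>\<^bsub>C\<^esub> f = G1 (FArr F f) \<cdot>\<^bsub>C\<^esub> \<alpha> (Dom C f)"
      by (rule faithful[of _ "Dom C f" "G0 (FObj F (Cod C f))"])
        (use a f ob C D FS B CC bc in \<open>auto intro!: homI simp: G1D G1(2)\<close>)
    then show "\<alpha> (Cod C f) \<cdot>\<^bsub>C\<^esub> FArr fid f = FArr (?G \<circ>\<^sub>F F) f \<cdot>\<^bsub>C\<^esub> \<alpha> (Dom C f)"
      by (simp add: fid_def fcomp_def)
  qed (use \<alpha> \<alpha>_iso in \<open>auto simp: fid_def fcomp_def\<close>)
  moreover have "nat_iso D D (F \<circ>\<^sub>F ?G) fid b"
    unfolding nat_iso_def nat_trans_def
  proof (intro conjI ballI is_functor_fid[OF cD] is_functor_fcomp[OF G F])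
    fix f assume f: "f \<in> Arr D"
    then show "b (Cod D f) \<cdot>\<^bsub>D\<^esub> FArr (F \<circ>\<^sub>F ?G) f = FArr fid f \<cdot>\<^bsub>D\<^esub> b (Dom D f)"
      by (simp add: fid_def fcomp_def G1(2) bc' D B)
  next
    fix x assume "x \<in> Obj D"
    then show "iso D (b x)" using isoI[OF b c cb bc] by simp
  qed (use b in \<open>auto simp: fid_def fcomp_def\<close>)
  ultimately show ?thesis unfolding equivalence_of_cats_def using F G by blast
qed


section \<open>Full subcategories of inserters\<close>

text \<open>Lax descent categories and categories of algebras are both of this form (with \<open>P = \<A>(d\<^sup>1)\<close> and
  \<open>Q = \<A>(d\<^sup>0)\<close>, and with \<open>P = T\<close> and \<open>Q = id\<close>): the structures are arrows \<open>P w \<rightarrow> Q w\<close> subject to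
  equations that are recorded in the set \<open>S\<close>.\<close>

definition full_inserter ::
  "('o1, 'm1) cat \<Rightarrow> ('o2, 'm2) cat \<Rightarrow> ('o1, 'm1, 'o2, 'm2) func \<Rightarrow> ('o1, 'm1, 'o2, 'm2) func
    \<Rightarrow> ('o1 \<times> 'm2) set \<Rightarrow> ('o1 \<times> 'm2, ('o1 \<times> 'm2) \<times> 'm1 \<times> ('o1 \<times> 'm2)) cat" where
  "full_inserter A A' P Q S = structured_cat A S
     (\<lambda>(w, \<phi>) m (w', \<phi>'). FArr Q m \<cdot>\<^bsub>A'\<^esub> \<phi> = \<phi>' \<cdot>\<^bsub>A'\<^esub> FArr P m)"

definition inserter_objects ::
  "('o1, 'm1) cat \<Rightarrow> ('o2, 'm2) cat \<Rightarrow> ('o1, 'm1, 'o2, 'm2) func \<Rightarrow> ('o1, 'm1, 'o2, 'm2) func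
    \<Rightarrow> ('o1 \<times> 'm2) set" where
  "inserter_objects A A' P Q = {(w, \<phi>). w \<in> Obj A \<and> \<phi> \<in> hom A' (FObj P w) (FObj Q w)}"

lemma full_inserter_Obj [simp]: "Obj (full_inserter A A' P Q S) = S"
  by (simp add: full_inserter_def structured_cat_def)

lemma full_inserter_Idn: "Idn (full_inserter A A' P Q S) X = (X, Idn A (fst X), X)"
  by (simp add: full_inserter_def structured_cat_def)

lemma full_inserter_Cmp:
  "(Y, n, Z) \<cdot>\<^bsub>full_inserter A A' P Q S\<^esub> (X, m, Y') = (X, n \<cdot>\<^bsub>A\<^esub> m, Z)"
  by (simp add: full_inserter_def structured_cat_def)

lemma full_inserter_hom_iff:
  "f \<in> hom (full_inserter A A' P Q S) (w, \<phi>) (w', \<phi>') \<longleftrightarrow>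
     (\<exists>m. f = ((w, \<phi>), m, (w', \<phi>')) \<and> (w, \<phi>) \<in> S \<and> (w', \<phi>') \<in> S \<and> m \<in> hom A w w' \<and>
       FArr Q m \<cdot>\<^bsub>A'\<^esub> \<phi> = \<phi>' \<cdot>\<^bsub>A'\<^esub> FArr P m)"
  by (auto simp: full_inserter_def structured_cat_def hom_def)

lemma full_inserter_Arr_iff:
  "f \<in> Arr (full_inserter A A' P Q S) \<longleftrightarrow>
     (\<exists>w \<phi> m w' \<phi>'. f = ((w, \<phi>), m, (w', \<phi>')) \<and> (w, \<phi>) \<in> S \<and> (w', \<phi>') \<in> S \<and>
       m \<in> hom A w w' \<and> FArr Q m \<cdot>\<^bsub>A'\<^esub> \<phi> = \<phi>' \<cdot>\<^bsub>A'\<^esub> FArr P m)"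
  by (auto simp: full_inserter_def structured_cat_def)

lemma full_inserter_Dom_Cod:
  "Dom (full_inserter A A' P Q S) (X, m, Y) = X"
  "Cod (full_inserter A A' P Q S) (X, m, Y) = Y"
  by (simp_all add: full_inserter_def structured_cat_def)

lemma category_full_inserter:
  assumes P: "is_functor A A' P" and Q: "is_functor A A' Q" and S: "S \<subseteq> inserter_objects A A' P Q"
  shows "category (full_inserter A A' P Q S)"
proof -
  let ?I = "full_inserter A A' P Q S"
  note cA = functor_categories(1)[OF P] and cA' = functor_categories(2)[OF P]
  note simps = category_simps[OF cA] category_simps[OF cA'] functor_simps[OF P] functor_simps[OF Q]
  have S': "w \<in> Obj A" "\<phi> \<in> Arr A'" "Dom A' \<phi> = FObj P w" "Cod A' \<phi> = FObj Q w" if "(w, \<phi>) \<in> S" for w \<phi>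
    using S that by (auto simp: inserter_objects_def hom_def)
  have comp: "FArr Q (n \<cdot>\<^bsub>A\<^esub> m) \<cdot>\<^bsub>A'\<^esub> \<phi> = \<phi>'' \<cdot>\<^bsub>A'\<^esub> FArr P (n \<cdot>\<^bsub>A\<^esub> m)"
    if "(w, \<phi>) \<in> S" "(w', \<phi>') \<in> S" "(w'', \<phi>'') \<in> S" and m: "m \<in> hom A w w'" and n: "n \<in> hom A w' w''"
      and em: "FArr Q m \<cdot>\<^bsub>A'\<^esub> \<phi> = \<phi>' \<cdot>\<^bsub>A'\<^esub> FArr P m"
      and en: "FArr Q n \<cdot>\<^bsub>A'\<^esub> \<phi>' = \<phi>'' \<cdot>\<^bsub>A'\<^esub> FArr P n" for w \<phi> w' \<phi>' w'' \<phi>'' m n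
  proof -
    note t = simps S'[OF that(1)] S'[OF that(2)] S'[OF that(3)] homD[OF m] homD[OF n]
    have "FArr Q (n \<cdot>\<^bsub>A\<^esub> m) \<cdot>\<^bsub>A'\<^esub> \<phi> = FArr Q n \<cdot>\<^bsub>A'\<^esub> (FArr Q m \<cdot>\<^bsub>A'\<^esub> \<phi>)" by (simp add: t)
    also have "\<dots> = FArr Q n \<cdot>\<^bsub>A'\<^esub> \<phi>' \<cdot>\<^bsub>A'\<^esub> FArr P m" unfolding em by (simp add: t)
    also have "\<dots> = \<phi>'' \<cdot>\<^bsub>A'\<^esub> FArr P (n \<cdot>\<^bsub>A\<^esub> m)" unfolding en by (simp add: t)
    finally show ?thesis .
  qed
  show ?thesis
    unfolding category_def
  proof (intro conjI ballI impI)
    fix f assume "f \<in> Arr ?I"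
    then obtain w \<phi> m w' \<phi>' where f: "f = ((w, \<phi>), m, (w', \<phi>'))"
      "(w, \<phi>) \<in> S" "(w', \<phi>') \<in> S" "m \<in> hom A w w'"
      unfolding full_inserter_Arr_iff by blast
    show "Dom ?I f \<in> Obj ?I" "Cod ?I f \<in> Obj ?I"
      using f by (simp_all add: full_inserter_Dom_Cod)
    show "Idn ?I (Cod ?I f) \<cdot>\<^bsub>?I\<^esub> f = f" "f \<cdot>\<^bsub>?I\<^esub> Idn ?I (Dom ?I f) = f"
      using f(1) hom_idn(1,2)[OF cA f(4)]
      by (simp_all add: full_inserter_Dom_Cod full_inserter_Idn full_inserter_Cmp)
  next
    fix X assume "X \<in> Obj ?I"
    then obtain w \<phi> where X: "X = (w, \<phi>)" "(w, \<phi>) \<in> S" by (cases X) simp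
    show "Idn ?I X \<in> hom ?I X X"
      using X(2) hom_idn(3)[OF cA] S'[OF X(2)]
      unfolding X(1) full_inserter_hom_iff full_inserter_Idn by (auto simp: simps intro!: homI)
  next
    fix f g assume "f \<in> Arr ?I" and gA: "g \<in> Arr ?I" and e: "Dom ?I g = Cod ?I f"
    then obtain w \<phi> m w' \<phi>' where f: "f = ((w, \<phi>), m, (w', \<phi>'))"
      "(w, \<phi>) \<in> S" "(w', \<phi>') \<in> S" "m \<in> hom A w w'" "FArr Q m \<cdot>\<^bsub>A'\<^esub> \<phi> = \<phi>' \<cdot>\<^bsub>A'\<^esub> FArr P m"
      unfolding full_inserter_Arr_iff by blast
    obtain n w'' \<phi>'' where g: "g = ((w', \<phi>'), n, (w'', \<phi>''))"
      "(w'', \<phi>'') \<in> S" "n \<in> hom A w' w''" "FArr Q n \<cdot>\<^bsub>A'\<^esub> \<phi>' = \<phi>'' \<cdot>\<^bsub>A'\<^esub> FArr P n"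
      using gA e unfolding full_inserter_Arr_iff f(1) by (auto simp: full_inserter_Dom_Cod)
    show "g \<cdot>\<^bsub>?I\<^esub> f \<in> hom ?I (Dom ?I f) (Cod ?I g)"
      unfolding f(1) g(1) full_inserter_Dom_Cod full_inserter_Cmp full_inserter_hom_iff
      using f(2) g(2) hom_comp[OF cA f(4) g(3)] comp[OF f(2,3) g(2) f(4) g(3) f(5) g(4)] by blast
  next
    fix f g h assume "f \<in> Arr ?I" and gA: "g \<in> Arr ?I" and hA: "h \<in> Arr ?I"
      and e: "Dom ?I g = Cod ?I f \<and> Dom ?I h = Cod ?I g"
    then obtain X w m w' \<phi>' where f: "f = (X, m, (w', \<phi>'))" "m \<in> hom A w w'"
      unfolding full_inserter_Arr_iff by blast
    obtain n w'' \<phi>'' where g: "g = ((w', \<phi>'), n, (w'', \<phi>''))" "n \<in> hom A w' w''"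
      using gA e unfolding full_inserter_Arr_iff f(1) by (auto simp: full_inserter_Dom_Cod)
    obtain k w3 \<phi>3 where h: "h = ((w'', \<phi>''), k, (w3, \<phi>3))" "k \<in> hom A w'' w3"
      using hA e unfolding full_inserter_Arr_iff g(1) by (auto simp: full_inserter_Dom_Cod)
    show "h \<cdot>\<^bsub>?I\<^esub> g \<cdot>\<^bsub>?I\<^esub> f = h \<cdot>\<^bsub>?I\<^esub> (g \<cdot>\<^bsub>?I\<^esub> f)"
      unfolding f(1) g(1) h(1) full_inserter_Cmp using hom_assoc[OF cA f(2) g(2) h(2)] by simp
  qed
qed

text \<open>If an isomorphism preserves the structures, so does its inverse: compose the defining square with
  the images of the inverse on both sides.\<close>

lemma full_inserter_iso_iff:
  assumes P: "is_functor A A' P" and Q: "is_functor A A' Q" and S: "S \<subseteq> inserter_objects A A' P Q"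
    and i: "((w, \<phi>), i, (w', \<phi>')) \<in> hom (full_inserter A A' P Q S) (w, \<phi>) (w', \<phi>')"
  shows "iso (full_inserter A A' P Q S) ((w, \<phi>), i, (w', \<phi>')) \<longleftrightarrow> iso A i"
proof
  assume "iso (full_inserter A A' P Q S) ((w, \<phi>), i, (w', \<phi>'))"
  from isoE[OF this i] obtain g where g: "g \<in> hom (full_inserter A A' P Q S) (w', \<phi>') (w, \<phi>)"
    "g \<cdot>\<^bsub>full_inserter A A' P Q S\<^esub> ((w, \<phi>), i, (w', \<phi>')) = Idn (full_inserter A A' P Q S) (w, \<phi>)"
    "((w, \<phi>), i, (w', \<phi>')) \<cdot>\<^bsub>full_inserter A A' P Q S\<^esub> g = Idn (full_inserter A A' P Q S) (w', \<phi>')"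
    by blast
  obtain j where gj: "g = ((w', \<phi>'), j, (w, \<phi>))" and j: "j \<in> hom A w' w"
    using g(1) unfolding full_inserter_hom_iff by blast
  have ih: "i \<in> hom A w w'" using i unfolding full_inserter_hom_iff by blast
  show "iso A i"
    using isoI[OF ih j] g(2,3) unfolding gj full_inserter_Cmp full_inserter_Idn by simp
next
  assume iso: "iso A i"
  note cA = functor_categories(1)[OF P] and cA' = functor_categories(2)[OF P]
  note simps = category_simps[OF cA] category_simps[OF cA'] functor_simps[OF P] functor_simps[OF Q]
  have mem: "(w, \<phi>) \<in> S" "(w', \<phi>') \<in> S" and ih: "i \<in> hom A w w'"
    and ie: "FArr Q i \<cdot>\<^bsub>A'\<^esub> \<phi> = \<phi>' \<cdot>\<^bsub>A'\<^esub> FArr P i"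
    using i by (auto simp: full_inserter_hom_iff)
  have S': "w \<in> Obj A" "\<phi> \<in> hom A' (FObj P w) (FObj Q w)" if "(w, \<phi>) \<in> S" for w \<phi>
    using S that by (auto simp: inserter_objects_def)
  obtain j where j: "j \<in> hom A w' w" "j \<cdot>\<^bsub>A\<^esub> i = Idn A w" "i \<cdot>\<^bsub>A\<^esub> j = Idn A w'"
    using isoE[OF iso ih] by blast
  note t = simps S'(1)[OF mem(1)] S'(1)[OF mem(2)] homD[OF S'(2)[OF mem(1)]] homD[OF S'(2)[OF mem(2)]]
    homD[OF ih] homD[OF j(1)]
  have PQ: "FArr P i \<cdot>\<^bsub>A'\<^esub> FArr P j = Idn A' (FObj P w')" "FArr Q j \<cdot>\<^bsub>A'\<^esub> FArr Q i = Idn A' (FObj Q w)"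
    using functor_simps(6)[OF P, of j i] functor_simps(6)[OF Q, of i j] j(2,3) by (simp_all add: t)
  have "FArr Q j \<cdot>\<^bsub>A'\<^esub> \<phi>' = FArr Q j \<cdot>\<^bsub>A'\<^esub> (\<phi>' \<cdot>\<^bsub>A'\<^esub> (FArr P i \<cdot>\<^bsub>A'\<^esub> FArr P j))"
    unfolding PQ by (simp add: t)
  also have "\<dots> = FArr Q j \<cdot>\<^bsub>A'\<^esub> (\<phi>' \<cdot>\<^bsub>A'\<^esub> FArr P i) \<cdot>\<^bsub>A'\<^esub> FArr P j" by (simp add: t)
  also have "\<dots> = FArr Q j \<cdot>\<^bsub>A'\<^esub> FArr Q i \<cdot>\<^bsub>A'\<^esub> \<phi> \<cdot>\<^bsub>A'\<^esub> FArr P j" unfolding ie[symmetric] by (simp add: t)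
  also have "\<dots> = \<phi> \<cdot>\<^bsub>A'\<^esub> FArr P j" unfolding PQ by (simp add: t)
  finally have "((w', \<phi>'), j, (w, \<phi>)) \<in> hom (full_inserter A A' P Q S) (w', \<phi>') (w, \<phi>)"
    using mem j(1) by (simp add: full_inserter_hom_iff)
  from isoI[OF i this] show "iso (full_inserter A A' P Q S) ((w, \<phi>), i, (w', \<phi>'))"
    using j by (simp add: full_inserter_Idn full_inserter_Cmp)
qed

lemma lax_Desc_eq_full_inserter:
  "lax_Desc \<A> = full_inserter (PCat \<A> 1) (PCat \<A> 2) (PFun \<A> (dd 1)) (PFun \<A> (dd 0)) (lax_descent_data \<A>)"
  by (simp add: lax_Desc_def full_inserter_def)

lemma EM_cat_eq_full_inserter:
  "EM_cat A T \<eta> \<mu> = full_inserter A A T fid (algebras A T \<eta> \<mu>)"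
  by (simp add: EM_cat_def full_inserter_def fid_def)

lemma algebras_subset_inserter: "algebras A T \<eta> \<mu> \<subseteq> inserter_objects A A T fid"
  by (auto simp: algebras_def inserter_objects_def fid_def)


section \<open>The Eilenberg-Moore comparison functor\<close>

lemma adjunctionD:
  assumes "adjunction B A L R \<eta> \<epsilon>"
  shows "is_functor A B L" "is_functor B A R"
    and "nat_trans A A fid (R \<circ>\<^sub>F L) \<eta>" "nat_trans B B (L \<circ>\<^sub>F R) fid \<epsilon>"
    and "a \<in> Obj A \<Longrightarrow> \<eta> a \<in> hom A a (FObj R (FObj L a))"
    and "b \<in> Obj B \<Longrightarrow> \<epsilon> b \<in> hom B (FObj L (FObj R b)) b"
    and "m \<in> hom A a a' \<Longrightarrow> \<eta> a' \<cdot>\<^bsub>A\<^esub> m = FArr R (FArr L m) \<cdot>\<^bsub>A\<^esub> \<eta> a"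
    and "u \<in> hom B b b' \<Longrightarrow> \<epsilon> b' \<cdot>\<^bsub>B\<^esub> FArr L (FArr R u) = u \<cdot>\<^bsub>B\<^esub> \<epsilon> b"
    and "a \<in> Obj A \<Longrightarrow> \<epsilon> (FObj L a) \<cdot>\<^bsub>B\<^esub> FArr L (\<eta> a) = Idn B (FObj L a)"
    and "b \<in> Obj B \<Longrightarrow> FArr R (\<epsilon> b) \<cdot>\<^bsub>A\<^esub> \<eta> (FObj R b) = Idn A (FObj R b)"
proof -
  show *: "is_functor A B L" "is_functor B A R"
     "nat_trans A A fid (R \<circ>\<^sub>F L) \<eta>" "nat_trans B B (L \<circ>\<^sub>F R) fid \<epsilon>"
    and "a \<in> Obj A \<Longrightarrow> \<epsilon> (FObj L a) \<cdot>\<^bsub>B\<^esub> FArr L (\<eta> a) = Idn B (FObj L a)"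
    and "b \<in> Obj B \<Longrightarrow> FArr R (\<epsilon> b) \<cdot>\<^bsub>A\<^esub> \<eta> (FObj R b) = Idn A (FObj R b)"
    using assms by (simp_all add: adjunction_def)
  show "a \<in> Obj A \<Longrightarrow> \<eta> a \<in> hom A a (FObj R (FObj L a))"
    and "b \<in> Obj B \<Longrightarrow> \<epsilon> b \<in> hom B (FObj L (FObj R b)) b"
    using *(3,4) by (simp_all add: nat_trans_def fid_def fcomp_def)
  show "m \<in> hom A a a' \<Longrightarrow> \<eta> a' \<cdot>\<^bsub>A\<^esub> m = FArr R (FArr L m) \<cdot>\<^bsub>A\<^esub> \<eta> a"
    and "u \<in> hom B b b' \<Longrightarrow> \<epsilon> b' \<cdot>\<^bsub>B\<^esub> FArr L (FArr R u) = u \<cdot>\<^bsub>B\<^esub> \<epsilon> b"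
    using nat_trans_natural[OF *(3)] nat_trans_natural[OF *(4)] by (fastforce simp: fid_def fcomp_def)+
qed

text \<open>The hypothesis says that \<open>u\<close> has the same transpose as \<open>\<epsilon>\<^sub>b\<close>, namely the identity. The computation
  recovers \<open>u\<close> from its transpose.\<close>

lemma adjunct_eq_counit:
  assumes adj: "adjunction B A L R \<eta> \<epsilon>" and b: "b \<in> Obj B"
    and u: "u \<in> hom B (FObj L (FObj R b)) b"
    and eq: "FArr R u \<cdot>\<^bsub>A\<^esub> \<eta> (FObj R b) = Idn A (FObj R b)"
  shows "u = \<epsilon> b"
proof -
  note a = adjunctionD[OF adj]
  note simps = category_simps[OF functor_categories(1)[OF a(2)]] category_simps[OF functor_categories(2)[OF a(2)]]
    functor_simps[OF a(1)] functor_simps[OF a(2)]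
  have Rb: "FObj R b \<in> Obj A" by (simp add: simps b)
  note t = simps homD[OF u] homD[OF a(5)[OF Rb]] homD[OF a(6)[OF b]] Rb b
    homD[OF a(6)[OF functor_simps(1)[OF a(1) Rb]]]
  have "u = u \<cdot>\<^bsub>B\<^esub> (\<epsilon> (FObj L (FObj R b)) \<cdot>\<^bsub>B\<^esub> FArr L (\<eta> (FObj R b)))"
    unfolding a(9)[OF Rb] by (simp add: t)
  also have "\<dots> = u \<cdot>\<^bsub>B\<^esub> \<epsilon> (FObj L (FObj R b)) \<cdot>\<^bsub>B\<^esub> FArr L (\<eta> (FObj R b))" by (simp add: t)
  also have "\<dots> = \<epsilon> b \<cdot>\<^bsub>B\<^esub> FArr L (FArr R u \<cdot>\<^bsub>A\<^esub> \<eta> (FObj R b))"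
    unfolding a(8)[OF u, symmetric] by (simp add: t)
  also have "\<dots> = \<epsilon> b" unfolding eq by (simp add: t)
  finally show ?thesis .
qed

text \<open>The associativity law of \<open>R \<epsilon>\<^sub>b\<close> is \<open>R\<close> applied to the naturality of \<open>\<epsilon>\<close> at \<open>\<epsilon>\<^sub>b\<close>; its unit law is
  a triangle identity.\<close>

lemma EM_comparison_functor:
  assumes adj: "adjunction B A L R \<eta> \<epsilon>"
  shows "category (EM_cat_of_adjunction A L R \<eta> \<epsilon>)"
    and "is_functor B (EM_cat_of_adjunction A L R \<eta> \<epsilon>) (EM_comparison B R \<epsilon>)"
proof -
  note a = adjunctionD[OF adj]
  note cB = functor_categories(1)[OF a(2)] and cA = functor_categories(2)[OF a(2)]
  note simps = category_simps[OF cB] category_simps[OF cA] functor_simps[OF a(1)] functor_simps[OF a(2)]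
  let ?T = "R \<circ>\<^sub>F L"
  let ?S = "algebras A ?T \<eta> (\<lambda>a. FArr R (\<epsilon> (FObj L a)))"
  have E: "EM_cat_of_adjunction A L R \<eta> \<epsilon> = full_inserter A A ?T fid ?S"
    by (simp add: EM_cat_of_adjunction_def EM_cat_eq_full_inserter)
  show cE: "category (EM_cat_of_adjunction A L R \<eta> \<epsilon>)"
    unfolding E by (rule category_full_inserter[OF is_functor_fcomp[OF a(1,2)] is_functor_fid[OF cA]
          algebras_subset_inserter])
  have alg: "(FObj R b, FArr R (\<epsilon> b)) \<in> ?S" if b: "b \<in> Obj B" for b
  proof -
    note e = a(6)[OF b]
    have LRb: "FObj L (FObj R b) \<in> Obj B" by (simp add: simps b)
    have "FArr R (\<epsilon> b) \<cdot>\<^bsub>A\<^esub> FArr R (\<epsilon> (FObj L (FObj R b))) = FArr R (\<epsilon> b) \<cdot>\<^bsub>A\<^esub> FArr R (FArr L (FArr R (\<epsilon> b)))"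
      using arg_cong[OF a(8)[OF e], of "FArr R"] homD[OF e] homD[OF a(6)[OF LRb]]
      by (simp add: simps b)
    then show ?thesis
      using b functor_hom[OF a(2) e] a(10)[OF b] by (simp add: algebras_def fcomp_def simps)
  qed
  have nat: "FArr R u \<cdot>\<^bsub>A\<^esub> FArr R (\<epsilon> b) = FArr R (\<epsilon> b') \<cdot>\<^bsub>A\<^esub> FArr R (FArr L (FArr R u))"
    if u: "u \<in> hom B b b'" for u b b'
    using arg_cong[OF a(8)[OF u], of "FArr R"] homD[OF u] homD[OF a(6)] hom_idn(5,6)[OF cB u]
    by (simp add: simps)
  show "is_functor B (EM_cat_of_adjunction A L R \<eta> \<epsilon>) (EM_comparison B R \<epsilon>)"
    unfolding is_functor_def
  proof (intro conjI ballI impI cE cB)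
    fix u assume u: "u \<in> Arr B"
    then have h: "u \<in> hom B (Dom B u) (Cod B u)" by (simp add: hom_def)
    show "FArr (EM_comparison B R \<epsilon>) u \<in> hom (EM_cat_of_adjunction A L R \<eta> \<epsilon>)
        (FObj (EM_comparison B R \<epsilon>) (Dom B u)) (FObj (EM_comparison B R \<epsilon>) (Cod B u))"
      using alg nat[OF h] functor_hom[OF a(2) h] u
      by (simp add: E EM_comparison_def Let_def full_inserter_hom_iff fid_def fcomp_def simps)
  qed (use alg in \<open>auto simp: E EM_comparison_def Let_def full_inserter_Idn full_inserter_Cmp simps\<close>)
qed


section \<open>Monadicity of functors factoring through an inserter\<close>

text \<open>The hypothesis \<open>split_quotient\<close> is the part of the creation of absolute colimits that monadicity
  relies on: a structure on \<open>a\<close> for which a split epimorphism from an object of \<open>S\<close> is structure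
  preserving satisfies the equations behind \<open>S\<close>. The conditions on \<open>K\<close> say that \<open>R\<close> is \<open>K\<close> followed
  by the forgetful functor.\<close>

locale inserter_equivalence =
  fixes A :: "('o1, 'm1) cat" and A' :: "('o2, 'm2) cat" and P Q S
    and B :: "('o3, 'm3) cat" and R K \<theta>
  assumes P: "is_functor A A' P" and Q: "is_functor A A' Q" and S: "S \<subseteq> inserter_objects A A' P Q"
    and split_quotient: "\<And>w \<phi> a \<psi> h s. (w, \<phi>) \<in> S \<Longrightarrow> h \<in> hom A w a \<Longrightarrow> s \<in> hom A a w \<Longrightarrow>
      h \<cdot>\<^bsub>A\<^esub> s = Idn A a \<Longrightarrow> \<psi> \<in> hom A' (FObj P a) (FObj Q a) \<Longrightarrow>
      FArr Q h \<cdot>\<^bsub>A'\<^esub> \<phi> = \<psi> \<cdot>\<^bsub>A'\<^esub> FArr P h \<Longrightarrow> (a, \<psi>) \<in> S"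
    and R: "is_functor B A R" and K: "equivalence_of_cats B (full_inserter A A' P Q S) K"
    and K_Obj: "\<And>x. x \<in> Obj B \<Longrightarrow> FObj K x = (FObj R x, \<theta> x)"
    and K_Arr: "\<And>u. u \<in> Arr B \<Longrightarrow> fst (snd (FArr K u)) = FArr R u"
begin

lemma KF: "is_functor B (full_inserter A A' P Q S) K"
  using K by (simp add: equivalence_of_cats_def)

lemma theta_mem: "x \<in> Obj B \<Longrightarrow> (FObj R x, \<theta> x) \<in> S"
  using functor_simps(1)[OF KF] K_Obj by (metis full_inserter_Obj)

lemma theta_hom: "x \<in> Obj B \<Longrightarrow> \<theta> x \<in> hom A' (FObj P (FObj R x)) (FObj Q (FObj R x))"
  using theta_mem S by (auto simp: inserter_objects_def)

lemma K_arr: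
  assumes "u \<in> hom B x y"
  shows "FArr K u = ((FObj R x, \<theta> x), FArr R u, (FObj R y, \<theta> y))"
    and "FArr Q (FArr R u) \<cdot>\<^bsub>A'\<^esub> \<theta> x = \<theta> y \<cdot>\<^bsub>A'\<^esub> FArr P (FArr R u)"
proof -
  note xy = hom_idn(5,6)[OF functor_categories(1)[OF R] assms]
  have "FArr K u \<in> hom (full_inserter A A' P Q S) (FObj R x, \<theta> x) (FObj R y, \<theta> y)"
    using functor_hom[OF KF assms] K_Obj[OF xy(1)] K_Obj[OF xy(2)] by metis
  then show "FArr K u = ((FObj R x, \<theta> x), FArr R u, (FObj R y, \<theta> y))"
    and "FArr Q (FArr R u) \<cdot>\<^bsub>A'\<^esub> \<theta> x = \<theta> y \<cdot>\<^bsub>A'\<^esub> FArr P (FArr R u)"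
    using K_Arr[OF homD(1)[OF assms]] by (auto simp: full_inserter_hom_iff)
qed

lemma lift_structure_preserving:
  assumes "x \<in> Obj B" "y \<in> Obj B" "m \<in> hom A (FObj R x) (FObj R y)"
    and "FArr Q m \<cdot>\<^bsub>A'\<^esub> \<theta> x = \<theta> y \<cdot>\<^bsub>A'\<^esub> FArr P m"
  shows "\<exists>u\<in>hom B x y. FArr R u = m"
proof -
  have "((FObj R x, \<theta> x), m, (FObj R y, \<theta> y)) \<in> hom (full_inserter A A' P Q S) (FObj K x) (FObj K y)"
    using assms theta_mem unfolding K_Obj[OF assms(1)] K_Obj[OF assms(2)] full_inserter_hom_iff by simp
  from fully_faithful_full[OF equivalence_fully_faithful[OF K] assms(1,2) this]
  obtain u where u: "u \<in> hom B x y" "FArr K u = ((FObj R x, \<theta> x), m, (FObj R y, \<theta> y))"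
    by blast
  then have "FArr R u = m" using K_arr(1)[OF u(1)] by simp
  with u(1) show ?thesis by blast
qed

lemma R_faithful:
  assumes "u \<in> hom B x y" "v \<in> hom B x y" "FArr R u = FArr R v"
  shows "u = v"
proof -
  have "FArr K u = FArr K v" using K_arr(1)[OF assms(1)] K_arr(1)[OF assms(2)] assms(3) by simp
  then show ?thesis
    by (rule fully_faithful_faithful[OF equivalence_fully_faithful[OF K] KF assms(1,2)])
qed

lemma K_essentially_surjective:
  assumes "(a, \<psi>) \<in> S"
  obtains b i where "b \<in> Obj B" "i \<in> hom A (FObj R b) a" "iso A i"
    "FArr Q i \<cdot>\<^bsub>A'\<^esub> \<theta> b = \<psi> \<cdot>\<^bsub>A'\<^esub> FArr P i"
proof -
  have "(a, \<psi>) \<in> Obj (full_inserter A A' P Q S)" using assms by simp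
  from equivalence_essentially_surjective[OF K, unfolded essentially_surjective_def, rule_format, OF this]
  obtain b f where b: "b \<in> Obj B" and f: "f \<in> hom (full_inserter A A' P Q S) (FObj K b) (a, \<psi>)"
    and fi: "iso (full_inserter A A' P Q S) f"
    by blast
  obtain i where i: "f = ((FObj R b, \<theta> b), i, (a, \<psi>))" "i \<in> hom A (FObj R b) a"
      "FArr Q i \<cdot>\<^bsub>A'\<^esub> \<theta> b = \<psi> \<cdot>\<^bsub>A'\<^esub> FArr P i"
    using f unfolding K_Obj[OF b] full_inserter_hom_iff by blast
  have "iso A i"
    using full_inserter_iso_iff[OF P Q S f[unfolded K_Obj[OF b] i(1)]] fi unfolding i(1) by (rule iffD1)
  with b i(2,3) show thesis by (intro that)
qed

text \<open>For an algebra morphism \<open>m\<close>, naturality of \<open>\<theta>\<close> at \<open>\<epsilon>\<^sub>b\<close>, \<open>L m\<close> and \<open>\<epsilon>\<^bsub>b'\<^esub>\<close> gives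
  \<open>Q m \<cdot> \<theta>\<^sub>b \<cdot> P R \<epsilon>\<^sub>b = \<theta>\<^bsub>b'\<^esub> \<cdot> P m \<cdot> P R \<epsilon>\<^sub>b\<close>. The arrow \<open>P R \<epsilon>\<^sub>b\<close> has the section \<open>P \<eta>\<^bsub>R b\<^esub>\<close>, so it cancels
  and \<open>m\<close> preserves the structures.\<close>

lemma algebra_morphism_lift:
  assumes adj: "adjunction B A L R \<eta> \<epsilon>" and b: "b \<in> Obj B" "b' \<in> Obj B"
    and m: "m \<in> hom A (FObj R b) (FObj R b')"
    and eq: "m \<cdot>\<^bsub>A\<^esub> FArr R (\<epsilon> b) = FArr R (\<epsilon> b') \<cdot>\<^bsub>A\<^esub> FArr R (FArr L m)"
  shows "\<exists>u\<in>hom B b b'. FArr R u = m"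
proof (rule lift_structure_preserving[OF b m])
  note a = adjunctionD[OF adj]
  note cA' = functor_categories(2)[OF P]
  note simps = category_simps[OF functor_categories(1)[OF P]] category_simps[OF cA']
    category_simps[OF functor_categories(1)[OF R]]
    functor_simps[OF P] functor_simps[OF Q] functor_simps[OF R] functor_simps[OF a(1)]
  have Rb: "FObj R b \<in> Obj A" "FObj R b' \<in> Obj A" by (simp_all add: simps b)
  note e = a(6)[OF b(1)] and e' = a(6)[OF b(2)]
  note Lm = functor_hom[OF a(1) m]
  note t = simps Rb b homD[OF m] homD[OF e] homD[OF e'] homD[OF theta_hom[OF b(1)]] homD[OF theta_hom[OF b(2)]]
     homD[OF a(5)[OF Rb(1)]]
    homD[OF theta_hom[OF functor_simps(1)[OF a(1) Rb(1)]]] homD[OF theta_hom[OF functor_simps(1)[OF a(1) Rb(2)]]]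
  note Re = functor_hom[OF R e] and \<eta> = a(5)[OF Rb(1)]
  have split: "FArr P (FArr R (\<epsilon> b)) \<cdot>\<^bsub>A'\<^esub> FArr P (\<eta> (FObj R b)) = Idn A' (FObj P (FObj R b))"
    using arg_cong[OF a(10)[OF b(1)], of "FArr P"] by (simp add: t)
  show "FArr Q m \<cdot>\<^bsub>A'\<^esub> \<theta> b = \<theta> b' \<cdot>\<^bsub>A'\<^esub> FArr P m"
  proof (rule split_epi_cancel[OF cA' functor_hom[OF P Re] functor_hom[OF P \<eta>] split])
    have "FArr Q m \<cdot>\<^bsub>A'\<^esub> \<theta> b \<cdot>\<^bsub>A'\<^esub> FArr P (FArr R (\<epsilon> b)) =
        FArr Q m \<cdot>\<^bsub>A'\<^esub> (\<theta> b \<cdot>\<^bsub>A'\<^esub> FArr P (FArr R (\<epsilon> b)))" by (simp add: t)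
    also have "\<dots> = FArr Q (m \<cdot>\<^bsub>A\<^esub> FArr R (\<epsilon> b)) \<cdot>\<^bsub>A'\<^esub> \<theta> (FObj L (FObj R b))"
      unfolding K_arr(2)[OF e, symmetric] by (simp add: t)
    also have "\<dots> = FArr Q (FArr R (\<epsilon> b')) \<cdot>\<^bsub>A'\<^esub> (FArr Q (FArr R (FArr L m)) \<cdot>\<^bsub>A'\<^esub> \<theta> (FObj L (FObj R b)))"
      unfolding eq by (simp add: t)
    also have "\<dots> = FArr Q (FArr R (\<epsilon> b')) \<cdot>\<^bsub>A'\<^esub> \<theta> (FObj L (FObj R b')) \<cdot>\<^bsub>A'\<^esub> FArr P (FArr R (FArr L m))"
      unfolding K_arr(2)[OF Lm] by (simp add: t)
    also have "\<dots> = \<theta> b' \<cdot>\<^bsub>A'\<^esub> FArr P (FArr R (\<epsilon> b') \<cdot>\<^bsub>A\<^esub> FArr R (FArr L m))"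
      unfolding K_arr(2)[OF e'] by (simp add: t)
    also have "\<dots> = \<theta> b' \<cdot>\<^bsub>A'\<^esub> FArr P m \<cdot>\<^bsub>A'\<^esub> FArr P (FArr R (\<epsilon> b))"
      unfolding eq[symmetric] by (simp add: t)
    finally show "FArr Q m \<cdot>\<^bsub>A'\<^esub> \<theta> b \<cdot>\<^bsub>A'\<^esub> FArr P (FArr R (\<epsilon> b)) =
        \<theta> b' \<cdot>\<^bsub>A'\<^esub> FArr P m \<cdot>\<^bsub>A'\<^esub> FArr P (FArr R (\<epsilon> b))" .
  qed (auto intro!: homI simp: t)
qed

text \<open>The structure \<open>\<psi>\<close> is forced: precomposing the first equation with \<open>P \<eta>\<^sub>a\<close>, a section of \<open>P h\<close>,
  yields the definition of \<open>\<psi>\<close>. That this choice works is the fact that \<open>h\<close> is the coequalizer of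
  \<open>R L h\<close> and \<open>R \<epsilon>\<^bsub>L a\<^esub>\<close>, split by \<open>\<eta>\<close>; both arrows preserve structures, being images under \<open>R\<close>.\<close>

lemma algebra_structure_preserving:
  assumes adj: "adjunction B A L R \<eta> \<epsilon>"
    and alg: "(a, h) \<in> algebras A (R \<circ>\<^sub>F L) \<eta> (\<lambda>a. FArr R (\<epsilon> (FObj L a)))"
  defines "\<psi> \<equiv> FArr Q h \<cdot>\<^bsub>A'\<^esub> \<theta> (FObj L a) \<cdot>\<^bsub>A'\<^esub> FArr P (\<eta> a)"
  shows "FArr Q h \<cdot>\<^bsub>A'\<^esub> \<theta> (FObj L a) = \<psi> \<cdot>\<^bsub>A'\<^esub> FArr P h" and "(a, \<psi>) \<in> S"
proof -
  note ad = adjunctionD[OF adj]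
  have a: "a \<in> Obj A" and h: "h \<in> hom A (FObj R (FObj L a)) a" and hu: "h \<cdot>\<^bsub>A\<^esub> \<eta> a = Idn A a"
    and hm: "h \<cdot>\<^bsub>A\<^esub> FArr R (\<epsilon> (FObj L a)) = h \<cdot>\<^bsub>A\<^esub> FArr R (FArr L h)"
    using alg by (simp_all add: algebras_def fcomp_def)
  note simps = category_simps[OF functor_categories(1)[OF P]] category_simps[OF functor_categories(2)[OF P]]
    category_simps[OF functor_categories(1)[OF R]]
    functor_simps[OF P] functor_simps[OF Q] functor_simps[OF R] functor_simps[OF ad(1)]
  let ?La = "FObj L a" let ?Ta = "FObj R ?La" let ?LTa = "FObj L ?Ta"
  have ob: "?La \<in> Obj B" "?Ta \<in> Obj A" "?LTa \<in> Obj B" by (simp_all add: simps a)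
  note Lh = functor_hom[OF ad(1) h] and e = ad(6)[OF ob(1)]
  note t = simps a ob homD[OF h] homD[OF ad(5)[OF a]] homD[OF ad(5)[OF ob(2)]]
    homD[OF theta_hom[OF ob(1)]] homD[OF theta_hom[OF ob(3)]] homD[OF e]
  \<comment> \<open>In turn: naturality of \<open>\<eta>\<close> at \<open>h\<close>, of \<open>\<theta>\<close> at \<open>L h\<close>, associativity of \<open>h\<close>, naturality of \<open>\<theta>\<close> at
    the counit, and a triangle identity.\<close>
  have "\<psi> \<cdot>\<^bsub>A'\<^esub> FArr P h = FArr Q h \<cdot>\<^bsub>A'\<^esub> \<theta> ?La \<cdot>\<^bsub>A'\<^esub> FArr P (\<eta> a \<cdot>\<^bsub>A\<^esub> h)"
    unfolding \<psi>_def by (simp add: t)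
  also have "\<dots> = FArr Q h \<cdot>\<^bsub>A'\<^esub> (\<theta> ?La \<cdot>\<^bsub>A'\<^esub> FArr P (FArr R (FArr L h))) \<cdot>\<^bsub>A'\<^esub> FArr P (\<eta> ?Ta)"
    unfolding ad(7)[OF h] by (simp add: t)
  also have "\<dots> = FArr Q (h \<cdot>\<^bsub>A\<^esub> FArr R (FArr L h)) \<cdot>\<^bsub>A'\<^esub> \<theta> ?LTa \<cdot>\<^bsub>A'\<^esub> FArr P (\<eta> ?Ta)"
    unfolding K_arr(2)[OF Lh, symmetric] by (simp add: t)
  also have "\<dots> = FArr Q h \<cdot>\<^bsub>A'\<^esub> (FArr Q (FArr R (\<epsilon> ?La)) \<cdot>\<^bsub>A'\<^esub> \<theta> ?LTa) \<cdot>\<^bsub>A'\<^esub> FArr P (\<eta> ?Ta)"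
    unfolding hm[symmetric] by (simp add: t)
  also have "\<dots> = FArr Q h \<cdot>\<^bsub>A'\<^esub> \<theta> ?La \<cdot>\<^bsub>A'\<^esub> FArr P (FArr R (\<epsilon> ?La) \<cdot>\<^bsub>A\<^esub> \<eta> ?Ta)"
    unfolding K_arr(2)[OF e] by (simp add: t)
  also have "\<dots> = FArr Q h \<cdot>\<^bsub>A'\<^esub> \<theta> ?La"
    unfolding ad(10)[OF ob(1)] by (simp add: t)
  finally show *: "FArr Q h \<cdot>\<^bsub>A'\<^esub> \<theta> ?La = \<psi> \<cdot>\<^bsub>A'\<^esub> FArr P h" by (rule sym)
  have "\<psi> \<in> hom A' (FObj P a) (FObj Q a)"
    unfolding \<psi>_def by (rule homI) (simp_all add: t)
  then show "(a, \<psi>) \<in> S"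
    by (rule split_quotient[OF theta_mem[OF ob(1)] h ad(5)[OF a] hu _ *])
qed

text \<open>As \<open>K\<close> is essentially surjective, there is an isomorphism \<open>i : R b \<rightarrow> a\<close> compatible with
  \<open>\<theta>\<^sub>b\<close> and the structure that \<open>h\<close> induces on \<open>a\<close>. To compare the algebra structures, lift \<open>i\<^sup>-\<^sup>1 \<cdot> h\<close> to \<open>v : L a \<rightarrow> b\<close> and identify \<open>v \<cdot> L i\<close> with the counit.\<close>

lemma EM_comparison_essentially_surjective:
  assumes adj: "adjunction B A L R \<eta> \<epsilon>"
    and alg: "(a, h) \<in> algebras A (R \<circ>\<^sub>F L) \<eta> (\<lambda>a. FArr R (\<epsilon> (FObj L a)))"
  obtains b i where "b \<in> Obj B" "i \<in> hom A (FObj R b) a" "iso A i"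
    "i \<cdot>\<^bsub>A\<^esub> FArr R (\<epsilon> b) = h \<cdot>\<^bsub>A\<^esub> FArr R (FArr L i)"
proof -
  note ad = adjunctionD[OF adj]
  note cA = functor_categories(1)[OF P]
  have a: "a \<in> Obj A" and h: "h \<in> hom A (FObj R (FObj L a)) a" and hu: "h \<cdot>\<^bsub>A\<^esub> \<eta> a = Idn A a"
    using alg by (simp_all add: algebras_def fcomp_def)
  note simps = category_simps[OF cA] category_simps[OF functor_categories(2)[OF P]]
    category_simps[OF functor_categories(1)[OF R]]
    functor_simps[OF P] functor_simps[OF Q] functor_simps[OF R] functor_simps[OF ad(1)]
  have La: "FObj L a \<in> Obj B" by (simp add: simps a)
  note hS = algebra_structure_preserving[OF adj alg]
  define \<psi> where "\<psi> = FArr Q h \<cdot>\<^bsub>A'\<^esub> \<theta> (FObj L a) \<cdot>\<^bsub>A'\<^esub> FArr P (\<eta> a)"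
  have \<psi>: "\<psi> \<in> hom A' (FObj P a) (FObj Q a)" using hS(2) S by (auto simp: \<psi>_def inserter_objects_def)
  obtain b i where b: "b \<in> Obj B" and i: "i \<in> hom A (FObj R b) a" and ii: "iso A i"
    and i\<psi>: "FArr Q i \<cdot>\<^bsub>A'\<^esub> \<theta> b = \<psi> \<cdot>\<^bsub>A'\<^esub> FArr P i"
    using K_essentially_surjective[OF hS(2)] unfolding \<psi>_def by blast
  obtain j where j: "j \<in> hom A a (FObj R b)" and ji: "j \<cdot>\<^bsub>A\<^esub> i = Idn A (FObj R b)" and ij: "i \<cdot>\<^bsub>A\<^esub> j = Idn A a"
    using isoE[OF ii i] by blast
  have Rb: "FObj R b \<in> Obj A" by (simp add: simps b)
  note t = simps a b La Rb homD[OF h] homD[OF i] homD[OF j] homD[OF \<psi>] homD[OF theta_hom[OF b]]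
    homD[OF theta_hom[OF La]] homD[OF ad(5)[OF a]] homD[OF ad(5)[OF Rb]]
  have "FArr Q (j \<cdot>\<^bsub>A\<^esub> h) \<cdot>\<^bsub>A'\<^esub> \<theta> (FObj L a) = FArr Q j \<cdot>\<^bsub>A'\<^esub> (\<psi> \<cdot>\<^bsub>A'\<^esub> FArr P (i \<cdot>\<^bsub>A\<^esub> j)) \<cdot>\<^bsub>A'\<^esub> FArr P h"
    unfolding ij using hS(1)[folded \<psi>_def] by (simp add: t)
  also have "\<dots> = FArr Q j \<cdot>\<^bsub>A'\<^esub> (\<psi> \<cdot>\<^bsub>A'\<^esub> FArr P i) \<cdot>\<^bsub>A'\<^esub> FArr P (j \<cdot>\<^bsub>A\<^esub> h)" by (simp add: t)
  also have "\<dots> = FArr Q (j \<cdot>\<^bsub>A\<^esub> i) \<cdot>\<^bsub>A'\<^esub> \<theta> b \<cdot>\<^bsub>A'\<^esub> FArr P (j \<cdot>\<^bsub>A\<^esub> h)"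
    unfolding i\<psi>[symmetric] by (simp add: t)
  also have "\<dots> = \<theta> b \<cdot>\<^bsub>A'\<^esub> FArr P (j \<cdot>\<^bsub>A\<^esub> h)" unfolding ji by (simp add: t)
  \<comment> \<open>So \<open>j \<cdot> h\<close>, where \<open>j\<close> is the inverse of \<open>i\<close>, preserves structures and lifts to \<open>B\<close>.\<close>
  finally obtain v where v: "v \<in> hom B (FObj L a) b" and Rv: "FArr R v = j \<cdot>\<^bsub>A\<^esub> h"
    using lift_structure_preserving[OF La b hom_comp[OF cA h j]] by blast
  note t = t homD[OF v]
  have "v \<cdot>\<^bsub>B\<^esub> FArr L i = \<epsilon> b"
  proof (rule adjunct_eq_counit[OF adj b])
    show "v \<cdot>\<^bsub>B\<^esub> FArr L i \<in> hom B (FObj L (FObj R b)) b" by (rule homI) (simp_all add: t)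
    have "FArr R (v \<cdot>\<^bsub>B\<^esub> FArr L i) \<cdot>\<^bsub>A\<^esub> \<eta> (FObj R b) = FArr R v \<cdot>\<^bsub>A\<^esub> (FArr R (FArr L i) \<cdot>\<^bsub>A\<^esub> \<eta> (FObj R b))"
      by (simp add: t)
    also have "\<dots> = j \<cdot>\<^bsub>A\<^esub> (h \<cdot>\<^bsub>A\<^esub> \<eta> a) \<cdot>\<^bsub>A\<^esub> i"
      unfolding Rv ad(7)[OF i, symmetric] by (simp add: t)
    also have "\<dots> = Idn A (FObj R b)" unfolding hu using ji by (simp add: t)
    finally show "FArr R (v \<cdot>\<^bsub>B\<^esub> FArr L i) \<cdot>\<^bsub>A\<^esub> \<eta> (FObj R b) = Idn A (FObj R b)" .
  qed
  from this[symmetric]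
  have "i \<cdot>\<^bsub>A\<^esub> FArr R (\<epsilon> b) = i \<cdot>\<^bsub>A\<^esub> (FArr R v \<cdot>\<^bsub>A\<^esub> FArr R (FArr L i))"
    by (simp add: t)
  also have "\<dots> = i \<cdot>\<^bsub>A\<^esub> j \<cdot>\<^bsub>A\<^esub> (h \<cdot>\<^bsub>A\<^esub> FArr R (FArr L i))" unfolding Rv by (simp add: t)
  also have "\<dots> = h \<cdot>\<^bsub>A\<^esub> FArr R (FArr L i)" unfolding ij by (simp add: t)
  finally show thesis using that b i ii by blast
qed

theorem monadic_of_inserter_equivalence:
  assumes "has_left_adjoint B A R"
  shows "monadic B A R"
  unfolding monadic_def
proof (intro conjI allI impI assms)
  fix L \<eta> \<epsilon> assume adj: "adjunction B A L R \<eta> \<epsilon>"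
  note ad = adjunctionD[OF adj] and cA = functor_categories(1)[OF P]
  let ?S = "algebras A (R \<circ>\<^sub>F L) \<eta> (\<lambda>a. FArr R (\<epsilon> (FObj L a)))"
  have E: "EM_cat_of_adjunction A L R \<eta> \<epsilon> = full_inserter A A (R \<circ>\<^sub>F L) fid ?S"
    by (simp add: EM_cat_of_adjunction_def EM_cat_eq_full_inserter)
  have Kobj: "FObj (EM_comparison B R \<epsilon>) b = (FObj R b, FArr R (\<epsilon> b))" for b
    by (simp add: EM_comparison_def Let_def)
  have Karr: "FArr (EM_comparison B R \<epsilon>) u = ((FObj R b, FArr R (\<epsilon> b)), FArr R u, (FObj R b', FArr R (\<epsilon> b')))"
    if "u \<in> hom B b b'" for u b b'
    using homD[OF that] by (simp add: EM_comparison_def Let_def)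
  have hom_iff: "f \<in> hom (EM_cat_of_adjunction A L R \<eta> \<epsilon>) (w, h) (w', h') \<longleftrightarrow>
     (\<exists>m. f = ((w, h), m, (w', h')) \<and> (w, h) \<in> ?S \<and> (w', h') \<in> ?S \<and> m \<in> hom A w w' \<and>
       m \<cdot>\<^bsub>A\<^esub> h = h' \<cdot>\<^bsub>A\<^esub> FArr R (FArr L m))" for f w h w' h'
    unfolding E full_inserter_hom_iff by (simp add: fid_def fcomp_def)
  show "equivalence_of_cats B (EM_cat_of_adjunction A L R \<eta> \<epsilon>) (EM_comparison B R \<epsilon>)"
  proof (rule equivalenceI[OF EM_comparison_functor(2)[OF adj]])
    show "fully_faithful B (EM_cat_of_adjunction A L R \<eta> \<epsilon>) (EM_comparison B R \<epsilon>)"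
      unfolding fully_faithful_def
    proof (intro ballI)
      fix x y f assume xy: "x \<in> Obj B" "y \<in> Obj B"
        and "f \<in> hom (EM_cat_of_adjunction A L R \<eta> \<epsilon>) (FObj (EM_comparison B R \<epsilon>) x) (FObj (EM_comparison B R \<epsilon>) y)"
      then obtain m where m: "f = ((FObj R x, FArr R (\<epsilon> x)), m, (FObj R y, FArr R (\<epsilon> y)))"
        "m \<in> hom A (FObj R x) (FObj R y)"
        "m \<cdot>\<^bsub>A\<^esub> FArr R (\<epsilon> x) = FArr R (\<epsilon> y) \<cdot>\<^bsub>A\<^esub> FArr R (FArr L m)"
        unfolding Kobj hom_iff by blast
      obtain u where "u \<in> hom B x y" "FArr R u = m"
        using algebra_morphism_lift[OF adj xy m(2,3)] by blast
      then show "\<exists>!u. u \<in> hom B x y \<and> FArr (EM_comparison B R \<epsilon>) u = f"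
        using Karr R_faithful unfolding m(1) by (metis prod.inject)
    qed
    show "essentially_surjective B (EM_cat_of_adjunction A L R \<eta> \<epsilon>) (EM_comparison B R \<epsilon>)"
      unfolding essentially_surjective_def
    proof
      fix X assume "X \<in> Obj (EM_cat_of_adjunction A L R \<eta> \<epsilon>)"
      then obtain a h where X: "X = (a, h)" and alg: "(a, h) \<in> ?S" unfolding E by (cases X) simp
      obtain b i where b: "b \<in> Obj B" and i: "i \<in> hom A (FObj R b) a" "iso A i"
        "i \<cdot>\<^bsub>A\<^esub> FArr R (\<epsilon> b) = h \<cdot>\<^bsub>A\<^esub> FArr R (FArr L i)"
        using EM_comparison_essentially_surjective[OF adj alg] by blast
      let ?f = "((FObj R b, FArr R (\<epsilon> b)), i, (a, h))"
      have "(FObj R b, FArr R (\<epsilon> b)) \<in> ?S"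
        using functor_simps(1)[OF EM_comparison_functor(2)[OF adj] b] unfolding E Kobj by simp
      then have f: "?f \<in> hom (EM_cat_of_adjunction A L R \<eta> \<epsilon>) (FObj R b, FArr R (\<epsilon> b)) (a, h)"
        unfolding hom_iff using i alg by blast
      moreover have "iso (EM_cat_of_adjunction A L R \<eta> \<epsilon>) ?f"
        using full_inserter_iso_iff[OF is_functor_fcomp[OF ad(1,2)] is_functor_fid[OF cA]
            algebras_subset_inserter f[unfolded E]] i(2) unfolding E by blast
      ultimately show "\<exists>b\<in>Obj B. \<exists>f\<in>hom (EM_cat_of_adjunction A L R \<eta> \<epsilon>) (FObj (EM_comparison B R \<epsilon>) b) X.
          iso (EM_cat_of_adjunction A L R \<eta> \<epsilon>) f"
        using b unfolding Kobj X by blast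
    qed
  qed
qed

end


section \<open>Lax descent data along split quotients\<close>

lemma pseudofunctorD:
  assumes "pseudofunctor D \<A>"
  shows "category D"
    and "x \<in> Obj D \<Longrightarrow> category (PCat \<A> x)"
    and "f \<in> hom D x y \<Longrightarrow> is_functor (PCat \<A> x) (PCat \<A> y) (PFun \<A> f)"
    and "g \<in> hom D x y \<Longrightarrow> h \<in> hom D y z \<Longrightarrow>
      nat_iso (PCat \<A> x) (PCat \<A> z) (PFun \<A> h \<circ>\<^sub>F PFun \<A> g) (PFun \<A> (h \<cdot>\<^bsub>D\<^esub> g)) (PComp \<A> h g)"
    and "x \<in> Obj D \<Longrightarrow> nat_iso (PCat \<A> x) (PCat \<A> x) fid (PFun \<A> (Idn D x)) (PUnit \<A> x)"
  using assms unfolding pseudofunctor_def hom_def by auto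

lemma inv_arr_inverse:
  assumes "category C" "iso C f"
  shows "inverse_arrows C f (inv_arr C f)"
proof -
  obtain g where g: "inverse_arrows C f g" using assms(2) unfolding iso_def by blast
  have "h = g" if "inverse_arrows C f h" for h
    by (rule split_epi_cancel[OF assms(1), of f "Dom C f" "Cod C f" g])
      (use that g in \<open>auto simp: inverse_arrows_def hom_def\<close>)
  with g show ?thesis unfolding inv_arr_def by (rule theI)
qed

text \<open>All the transformations in the definition of descent data have the form \<open>\<rho>\<^sup>-\<^sup>1 \<cdot> \<tau>\<close> with structure
  isomorphisms \<open>\<rho>\<close> and \<open>\<tau>\<close> of the pseudofunctor.\<close>

lemma nat_trans_inverse_comp:
  assumes \<tau>: "nat_trans C D F G \<tau>" and \<rho>: "nat_iso C D H G \<rho>"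
  shows "nat_trans C D F H (\<lambda>x. inv_arr D (\<rho> x) \<cdot>\<^bsub>D\<^esub> \<tau> x)"
proof -
  have \<rho>': "nat_trans C D H G \<rho>" using \<rho> by (simp add: nat_iso_def)
  have FH: "is_functor C D F" "is_functor C D H" "is_functor C D G"
    using \<tau> \<rho>' by (simp_all add: nat_trans_def)
  note cC = functor_categories(1)[OF FH(1)] and cD = functor_categories(2)[OF FH(1)]
  note simps = category_simps[OF cC] category_simps[OF cD] functor_simps[OF FH(1)] functor_simps[OF FH(2)]
    functor_simps[OF FH(3)] nat_trans_simps[OF \<tau>] nat_trans_simps[OF \<rho>']
  have inv: "inverse_arrows D (\<rho> x) (inv_arr D (\<rho> x))" if "x \<in> Obj C" for x
    using inv_arr_inverse[OF cD] \<rho> that by (simp add: nat_iso_def)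
  have i: "inv_arr D (\<rho> x) \<in> hom D (FObj G x) (FObj H x)"
    "inv_arr D (\<rho> x) \<cdot>\<^bsub>D\<^esub> \<rho> x = Idn D (FObj H x)" "\<rho> x \<cdot>\<^bsub>D\<^esub> inv_arr D (\<rho> x) = Idn D (FObj G x)" if "x \<in> Obj C" for x
    using inv[OF that] that by (simp_all add: inverse_arrows_def simps)
  note iD = homD[OF i(1)]
  show ?thesis
    unfolding nat_trans_def
  proof (intro conjI ballI FH(1,2))
    fix x assume "x \<in> Obj C"
    then show "inv_arr D (\<rho> x) \<cdot>\<^bsub>D\<^esub> \<tau> x \<in> hom D (FObj F x) (FObj H x)"
      by (auto intro!: homI simp: simps iD)
  next
    fix f assume f: "f \<in> Arr C"
    let ?x = "Dom C f" let ?y = "Cod C f"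
    have xy: "?x \<in> Obj C" "?y \<in> Obj C" "f \<in> hom C ?x ?y" using f by (simp_all add: simps hom_def)
    note t = simps f xy(1,2) iD
    show "inv_arr D (\<rho> ?y) \<cdot>\<^bsub>D\<^esub> \<tau> ?y \<cdot>\<^bsub>D\<^esub> FArr F f = FArr H f \<cdot>\<^bsub>D\<^esub> (inv_arr D (\<rho> ?x) \<cdot>\<^bsub>D\<^esub> \<tau> ?x)"
    proof (rule split_mono_cancel[OF cD _ i(1)[OF xy(2)] i(2)[OF xy(2)]])
      have "\<rho> ?y \<cdot>\<^bsub>D\<^esub> (inv_arr D (\<rho> ?y) \<cdot>\<^bsub>D\<^esub> \<tau> ?y \<cdot>\<^bsub>D\<^esub> FArr F f) =
          \<rho> ?y \<cdot>\<^bsub>D\<^esub> inv_arr D (\<rho> ?y) \<cdot>\<^bsub>D\<^esub> (\<tau> ?y \<cdot>\<^bsub>D\<^esub> FArr F f)" by (simp add: t)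
      also have "\<dots> = FArr G f \<cdot>\<^bsub>D\<^esub> \<tau> ?x"
        unfolding i(3)[OF xy(2)] nat_trans_natural[OF \<tau> xy(3)] by (simp add: t)
      also have "\<dots> = FArr G f \<cdot>\<^bsub>D\<^esub> (\<rho> ?x \<cdot>\<^bsub>D\<^esub> inv_arr D (\<rho> ?x)) \<cdot>\<^bsub>D\<^esub> \<tau> ?x"
        unfolding i(3)[OF xy(1)] by (simp add: t)
      also have "\<dots> = FArr G f \<cdot>\<^bsub>D\<^esub> \<rho> ?x \<cdot>\<^bsub>D\<^esub> (inv_arr D (\<rho> ?x) \<cdot>\<^bsub>D\<^esub> \<tau> ?x)"
        by (simp add: t)
      also have "\<dots> = \<rho> ?y \<cdot>\<^bsub>D\<^esub> (FArr H f \<cdot>\<^bsub>D\<^esub> (inv_arr D (\<rho> ?x) \<cdot>\<^bsub>D\<^esub> \<tau> ?x))"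
        unfolding nat_trans_natural[OF \<rho>' xy(3), symmetric] by (simp add: t)
      finally show "\<rho> ?y \<cdot>\<^bsub>D\<^esub> (inv_arr D (\<rho> ?y) \<cdot>\<^bsub>D\<^esub> \<tau> ?y \<cdot>\<^bsub>D\<^esub> FArr F f) =
          \<rho> ?y \<cdot>\<^bsub>D\<^esub> (FArr H f \<cdot>\<^bsub>D\<^esub> (inv_arr D (\<rho> ?x) \<cdot>\<^bsub>D\<^esub> \<tau> ?x))" .
    qed (auto intro!: homI simp: t)
  qed
qed

lemma Delta3_generators_hom:
  "dd 0 \<in> hom Delta3 1 2" "dd 1 \<in> hom Delta3 1 2" "s0 \<in> hom Delta3 2 1"
  "DD 0 \<in> hom Delta3 2 3" "DD 1 \<in> hom Delta3 2 3" "DD 2 \<in> hom Delta3 2 3"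
proof -
  have d: "dd i \<in> hom Delta3 1 2" if "i \<le> 1" for i
    using Delta3_arr.intros(2)[OF that] by (simp add: hom_def Delta3_def fin_ord_cat_def coface_def)
  have D: "DD i \<in> hom Delta3 2 3" if "i \<le> 2" for i
    using Delta3_arr.intros(4)[OF that] by (simp add: hom_def Delta3_def fin_ord_cat_def coface_def)
  show "dd 0 \<in> hom Delta3 1 2" "dd 1 \<in> hom Delta3 1 2" by (rule d, simp)+
  show "DD 0 \<in> hom Delta3 2 3" "DD 1 \<in> hom Delta3 2 3" "DD 2 \<in> hom Delta3 2 3" by (rule D, simp)+
  show "s0 \<in> hom Delta3 2 1"
    using Delta3_arr.intros(3) by (simp add: hom_def Delta3_def fin_ord_cat_def s0_def)
qed

lemma Delta3_cosimplicial_identities: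
  "DD 1 \<cdot>\<^bsub>Delta3\<^esub> dd 0 = DD 0 \<cdot>\<^bsub>Delta3\<^esub> dd 0"
  "DD 2 \<cdot>\<^bsub>Delta3\<^esub> dd 0 = DD 0 \<cdot>\<^bsub>Delta3\<^esub> dd 1"
  "DD 2 \<cdot>\<^bsub>Delta3\<^esub> dd 1 = DD 1 \<cdot>\<^bsub>Delta3\<^esub> dd 1"
  using Delta3_relations(3)[of 0 1] Delta3_relations(3)[of 0 2] Delta3_relations(3)[of 1 2] by simp_all

lemma comparison_natural:
  assumes \<A>: "pseudofunctor D \<A>" and "g \<in> hom D x y" "h \<in> hom D y z" "g' \<in> hom D x y'" "h' \<in> hom D y' z"
    and eq: "h \<cdot>\<^bsub>D\<^esub> g = h' \<cdot>\<^bsub>D\<^esub> g'"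
  shows "nat_trans (PCat \<A> x) (PCat \<A> z) (PFun \<A> h \<circ>\<^sub>F PFun \<A> g) (PFun \<A> h' \<circ>\<^sub>F PFun \<A> g')
    (\<lambda>w. inv_arr (PCat \<A> z) (PComp \<A> h' g' w) \<cdot>\<^bsub>PCat \<A> z\<^esub> PComp \<A> h g w)"
  using nat_trans_inverse_comp pseudofunctorD(4)[OF \<A> assms(2,3)] pseudofunctorD(4)[OF \<A> assms(4,5)]
  unfolding eq nat_iso_def by blast

lemma sigma_natural:
  assumes \<A>: "pseudofunctor Delta3 \<A>"
  shows "nat_trans (PCat \<A> 1) (PCat \<A> 3) (PFun \<A> (DD 1) \<circ>\<^sub>F PFun \<A> (dd 0)) (PFun \<A> (DD 0) \<circ>\<^sub>F PFun \<A> (dd 0)) (sigma01 \<A>)"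
    and "nat_trans (PCat \<A> 1) (PCat \<A> 3) (PFun \<A> (DD 2) \<circ>\<^sub>F PFun \<A> (dd 0)) (PFun \<A> (DD 0) \<circ>\<^sub>F PFun \<A> (dd 1)) (sigma02 \<A>)"
    and "nat_trans (PCat \<A> 1) (PCat \<A> 3) (PFun \<A> (DD 2) \<circ>\<^sub>F PFun \<A> (dd 1)) (PFun \<A> (DD 1) \<circ>\<^sub>F PFun \<A> (dd 1)) (sigma12 \<A>)"
  unfolding sigma01_def sigma02_def sigma12_def
  by (rule comparison_natural[OF \<A>] Delta3_generators_hom Delta3_cosimplicial_identities)+

lemma nn_natural:
  assumes \<A>: "pseudofunctor Delta3 \<A>"
  shows "nat_trans (PCat \<A> 1) (PCat \<A> 1) (PFun \<A> s0 \<circ>\<^sub>F PFun \<A> (dd 0)) fid (nn0 \<A>)"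
    and "nat_trans (PCat \<A> 1) (PCat \<A> 1) (PFun \<A> s0 \<circ>\<^sub>F PFun \<A> (dd 1)) fid (nn1 \<A>)"
  unfolding nn0_def nn1_def
  using nat_trans_inverse_comp[OF _ pseudofunctorD(5)[OF \<A>, of 1]]
    pseudofunctorD(4)[OF \<A> Delta3_generators_hom(1,3)] pseudofunctorD(4)[OF \<A> Delta3_generators_hom(2,3)]
    hom_idn(5)[OF category_Delta3 Delta3_generators_hom(1)]
  unfolding Delta3_relations nat_iso_def by blast+

text \<open>Naturality of the \<open>\<sigma>\<close>'s and \<open>nn\<close>'s at \<open>h\<close>, together with the compatibility of \<open>h\<close> with \<open>\<phi>\<close> and
  \<open>\<psi>\<close>, turns either side of an equation for \<open>\<psi>\<close>, precomposed with \<open>\<A>(D\<^sup>2) \<A>(d\<^sup>1) h\<close> or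
  \<open>\<A>(s\<^sup>0) \<A>(d\<^sup>1) h\<close>, into the corresponding side of the equation for \<open>\<phi>\<close>, postcomposed with an image
  of \<open>h\<close>. The precomposed arrows are split epimorphisms and cancel.\<close>

lemma lax_descent_data_split_quotient:
  assumes \<A>: "pseudofunctor Delta3 \<A>" and X: "(w, \<phi>) \<in> lax_descent_data \<A>"
    and h: "h \<in> hom (PCat \<A> 1) w a" and s: "s \<in> hom (PCat \<A> 1) a w"
    and hs: "h \<cdot>\<^bsub>PCat \<A> 1\<^esub> s = Idn (PCat \<A> 1) a"
    and \<psi>: "\<psi> \<in> hom (PCat \<A> 2) (FObj (PFun \<A> (dd 1)) a) (FObj (PFun \<A> (dd 0)) a)"
    and eq: "FArr (PFun \<A> (dd 0)) h \<cdot>\<^bsub>PCat \<A> 2\<^esub> \<phi> = \<psi> \<cdot>\<^bsub>PCat \<A> 2\<^esub> FArr (PFun \<A> (dd 1)) h"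
  shows "(a, \<psi>) \<in> lax_descent_data \<A>"
proof -
  \<comment> \<open>Otherwise the object \<open>1\<close> would be rewritten to \<open>Suc 0\<close> in the goals, out of reach of the rules.\<close>
  note [simp del] = One_nat_def
  let ?A = "PCat \<A> 1" let ?B = "PCat \<A> 2" let ?C = "PCat \<A> 3"
  define d0 where "d0 = PFun \<A> (dd 0)"
  define d1 where "d1 = PFun \<A> (dd 1)"
  define D0 where "D0 = PFun \<A> (DD 0)"
  define D1 where "D1 = PFun \<A> (DD 1)"
  define D2 where "D2 = PFun \<A> (DD 2)"
  define t0 where "t0 = PFun \<A> s0"
  note folds = d0_def[symmetric] d1_def[symmetric] D0_def[symmetric] D1_def[symmetric] D2_def[symmetric] t0_def[symmetric]
  note pf = pseudofunctorD(3)[OF \<A>]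
  have F: "is_functor ?A ?B d0" "is_functor ?A ?B d1" "is_functor ?B ?C D0" "is_functor ?B ?C D1"
    "is_functor ?B ?C D2" "is_functor ?B ?A t0"
    unfolding d0_def d1_def D0_def D1_def D2_def t0_def by (rule pf Delta3_generators_hom)+
  have cA: "category ?A" and cB: "category ?B" and cC: "category ?C"
    using functor_categories F(1,3) by blast+
  note sn = sigma_natural[OF \<A>, unfolded folds]
  note nn = nn_natural[OF \<A>, unfolded folds]
  note eq = eq[unfolded folds] and \<psi> = \<psi>[unfolded folds]
  have w: "w \<in> Obj ?A" and \<phi>: "\<phi> \<in> hom ?B (FObj d1 w) (FObj d0 w)"
    and cocycle: "FArr D0 \<phi> \<cdot>\<^bsub>?C\<^esub> sigma02 \<A> w \<cdot>\<^bsub>?C\<^esub> FArr D2 \<phi> = sigma01 \<A> w \<cdot>\<^bsub>?C\<^esub> FArr D1 \<phi> \<cdot>\<^bsub>?C\<^esub> sigma12 \<A> w"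
    and unit: "nn0 \<A> w \<cdot>\<^bsub>?A\<^esub> FArr t0 \<phi> = nn1 \<A> w"
    using X unfolding lax_descent_data_def folds by auto
  have a: "a \<in> Obj ?A" using hom_idn(6)[OF cA h] .
  note t = category_simps[OF cA] category_simps[OF cB] category_simps[OF cC] functor_simps[OF F(1)]
    functor_simps[OF F(2)] functor_simps[OF F(3)] functor_simps[OF F(4)] functor_simps[OF F(5)] functor_simps[OF F(6)]
    w a homD[OF h] homD[OF s] homD[OF \<phi>] homD[OF \<psi>]
    nat_trans_simps[OF sn(1)] nat_trans_simps[OF sn(2)] nat_trans_simps[OF sn(3)]
    nat_trans_simps[OF nn(1)] nat_trans_simps[OF nn(2)] fcomp_def fid_def
  have n: "sigma01 \<A> a \<cdot>\<^bsub>?C\<^esub> FArr D1 (FArr d0 h) = FArr D0 (FArr d0 h) \<cdot>\<^bsub>?C\<^esub> sigma01 \<A> w"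
    "sigma02 \<A> a \<cdot>\<^bsub>?C\<^esub> FArr D2 (FArr d0 h) = FArr D0 (FArr d1 h) \<cdot>\<^bsub>?C\<^esub> sigma02 \<A> w"
    "sigma12 \<A> a \<cdot>\<^bsub>?C\<^esub> FArr D2 (FArr d1 h) = FArr D1 (FArr d1 h) \<cdot>\<^bsub>?C\<^esub> sigma12 \<A> w"
    "nn0 \<A> a \<cdot>\<^bsub>?A\<^esub> FArr t0 (FArr d0 h) = h \<cdot>\<^bsub>?A\<^esub> nn0 \<A> w"
    "nn1 \<A> a \<cdot>\<^bsub>?A\<^esub> FArr t0 (FArr d1 h) = h \<cdot>\<^bsub>?A\<^esub> nn1 \<A> w"
    using sn[THEN nat_trans_natural, OF h] nn[THEN nat_trans_natural, OF h]
    by (simp_all add: fcomp_def fid_def)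
  have E: "FArr D0 \<psi> \<cdot>\<^bsub>?C\<^esub> FArr D0 (FArr d1 h) = FArr D0 (FArr d0 h) \<cdot>\<^bsub>?C\<^esub> FArr D0 \<phi>"
    "FArr D1 \<psi> \<cdot>\<^bsub>?C\<^esub> FArr D1 (FArr d1 h) = FArr D1 (FArr d0 h) \<cdot>\<^bsub>?C\<^esub> FArr D1 \<phi>"
    "FArr D2 \<psi> \<cdot>\<^bsub>?C\<^esub> FArr D2 (FArr d1 h) = FArr D2 (FArr d0 h) \<cdot>\<^bsub>?C\<^esub> FArr D2 \<phi>"
    "FArr t0 \<psi> \<cdot>\<^bsub>?A\<^esub> FArr t0 (FArr d1 h) = FArr t0 (FArr d0 h) \<cdot>\<^bsub>?A\<^esub> FArr t0 \<phi>"
    using arg_cong[OF eq, of "FArr D0"] arg_cong[OF eq, of "FArr D1"] arg_cong[OF eq, of "FArr D2"]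
      arg_cong[OF eq, of "FArr t0"] by (simp_all add: t)
  have "FArr d1 h \<cdot>\<^bsub>?B\<^esub> FArr d1 s = Idn ?B (FObj d1 a)"
    using arg_cong[OF hs, of "FArr d1"] by (simp add: t)
  note split = this arg_cong[OF this, of "FArr D2"] arg_cong[OF this, of "FArr t0"]
  have "FArr D0 \<psi> \<cdot>\<^bsub>?C\<^esub> sigma02 \<A> a \<cdot>\<^bsub>?C\<^esub> FArr D2 \<psi> = sigma01 \<A> a \<cdot>\<^bsub>?C\<^esub> FArr D1 \<psi> \<cdot>\<^bsub>?C\<^esub> sigma12 \<A> a"
  proof (rule split_epi_cancel[OF cC])
    have "FArr D0 \<psi> \<cdot>\<^bsub>?C\<^esub> sigma02 \<A> a \<cdot>\<^bsub>?C\<^esub> FArr D2 \<psi> \<cdot>\<^bsub>?C\<^esub> FArr D2 (FArr d1 h) =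
        FArr D0 \<psi> \<cdot>\<^bsub>?C\<^esub> sigma02 \<A> a \<cdot>\<^bsub>?C\<^esub> (FArr D2 \<psi> \<cdot>\<^bsub>?C\<^esub> FArr D2 (FArr d1 h))" by (simp add: t)
    also have "\<dots> = FArr D0 \<psi> \<cdot>\<^bsub>?C\<^esub> (sigma02 \<A> a \<cdot>\<^bsub>?C\<^esub> FArr D2 (FArr d0 h)) \<cdot>\<^bsub>?C\<^esub> FArr D2 \<phi>"
      unfolding E(3) by (simp add: t)
    also have "\<dots> = FArr D0 \<psi> \<cdot>\<^bsub>?C\<^esub> FArr D0 (FArr d1 h) \<cdot>\<^bsub>?C\<^esub> (sigma02 \<A> w \<cdot>\<^bsub>?C\<^esub> FArr D2 \<phi>)"
      unfolding n by (simp add: t)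
    also have "\<dots> = FArr D0 (FArr d0 h) \<cdot>\<^bsub>?C\<^esub> (FArr D0 \<phi> \<cdot>\<^bsub>?C\<^esub> sigma02 \<A> w \<cdot>\<^bsub>?C\<^esub> FArr D2 \<phi>)"
      unfolding E(1) by (simp add: t)
    also have "\<dots> = FArr D0 (FArr d0 h) \<cdot>\<^bsub>?C\<^esub> sigma01 \<A> w \<cdot>\<^bsub>?C\<^esub> (FArr D1 \<phi> \<cdot>\<^bsub>?C\<^esub> sigma12 \<A> w)"
      unfolding cocycle by (simp add: t)
    also have "\<dots> = sigma01 \<A> a \<cdot>\<^bsub>?C\<^esub> (FArr D1 (FArr d0 h) \<cdot>\<^bsub>?C\<^esub> FArr D1 \<phi>) \<cdot>\<^bsub>?C\<^esub> sigma12 \<A> w"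
      unfolding n(1)[symmetric] by (simp add: t)
    also have "\<dots> = sigma01 \<A> a \<cdot>\<^bsub>?C\<^esub> FArr D1 \<psi> \<cdot>\<^bsub>?C\<^esub> (FArr D1 (FArr d1 h) \<cdot>\<^bsub>?C\<^esub> sigma12 \<A> w)"
      unfolding E(2)[symmetric] by (simp add: t)
    also have "\<dots> = sigma01 \<A> a \<cdot>\<^bsub>?C\<^esub> FArr D1 \<psi> \<cdot>\<^bsub>?C\<^esub> sigma12 \<A> a \<cdot>\<^bsub>?C\<^esub> FArr D2 (FArr d1 h)"
      unfolding n(3)[symmetric] by (simp add: t)
    finally show "FArr D0 \<psi> \<cdot>\<^bsub>?C\<^esub> sigma02 \<A> a \<cdot>\<^bsub>?C\<^esub> FArr D2 \<psi> \<cdot>\<^bsub>?C\<^esub> FArr D2 (FArr d1 h) =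
      sigma01 \<A> a \<cdot>\<^bsub>?C\<^esub> FArr D1 \<psi> \<cdot>\<^bsub>?C\<^esub> sigma12 \<A> a \<cdot>\<^bsub>?C\<^esub> FArr D2 (FArr d1 h)" .
    show "FArr D2 (FArr d1 s) \<in> hom ?C (FObj D2 (FObj d1 a)) (FObj D2 (FObj d1 w))"
      "FArr D2 (FArr d1 h) \<in> hom ?C (FObj D2 (FObj d1 w)) (FObj D2 (FObj d1 a))"
      by (auto intro!: homI simp: t)
    show "FArr D2 (FArr d1 h) \<cdot>\<^bsub>?C\<^esub> FArr D2 (FArr d1 s) = Idn ?C (FObj D2 (FObj d1 a))"
      using split(2) by (simp add: t)
    show "FArr D0 \<psi> \<cdot>\<^bsub>?C\<^esub> sigma02 \<A> a \<cdot>\<^bsub>?C\<^esub> FArr D2 \<psi> \<in> hom ?C (FObj D2 (FObj d1 a)) (FObj D0 (FObj d0 a))"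
      "sigma01 \<A> a \<cdot>\<^bsub>?C\<^esub> FArr D1 \<psi> \<cdot>\<^bsub>?C\<^esub> sigma12 \<A> a \<in> hom ?C (FObj D2 (FObj d1 a)) (FObj D0 (FObj d0 a))"
      by (auto intro!: homI simp: t)
  qed
  moreover have "nn0 \<A> a \<cdot>\<^bsub>?A\<^esub> FArr t0 \<psi> = nn1 \<A> a"
  proof (rule split_epi_cancel[OF cA])
    have "nn0 \<A> a \<cdot>\<^bsub>?A\<^esub> FArr t0 \<psi> \<cdot>\<^bsub>?A\<^esub> FArr t0 (FArr d1 h) =
        nn0 \<A> a \<cdot>\<^bsub>?A\<^esub> (FArr t0 \<psi> \<cdot>\<^bsub>?A\<^esub> FArr t0 (FArr d1 h))" by (simp add: t)
    also have "\<dots> = nn0 \<A> a \<cdot>\<^bsub>?A\<^esub> FArr t0 (FArr d0 h) \<cdot>\<^bsub>?A\<^esub> FArr t0 \<phi>"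
      unfolding E(4) by (simp add: t)
    also have "\<dots> = h \<cdot>\<^bsub>?A\<^esub> (nn0 \<A> w \<cdot>\<^bsub>?A\<^esub> FArr t0 \<phi>)" unfolding n by (simp add: t)
    also have "\<dots> = nn1 \<A> a \<cdot>\<^bsub>?A\<^esub> FArr t0 (FArr d1 h)" unfolding unit n ..
    finally show "nn0 \<A> a \<cdot>\<^bsub>?A\<^esub> FArr t0 \<psi> \<cdot>\<^bsub>?A\<^esub> FArr t0 (FArr d1 h) = nn1 \<A> a \<cdot>\<^bsub>?A\<^esub> FArr t0 (FArr d1 h)" .
    show "FArr t0 (FArr d1 s) \<in> hom ?A (FObj t0 (FObj d1 a)) (FObj t0 (FObj d1 w))"
      "FArr t0 (FArr d1 h) \<in> hom ?A (FObj t0 (FObj d1 w)) (FObj t0 (FObj d1 a))"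
      by (auto intro!: homI simp: t)
    show "FArr t0 (FArr d1 h) \<cdot>\<^bsub>?A\<^esub> FArr t0 (FArr d1 s) = Idn ?A (FObj t0 (FObj d1 a))"
      using split(3) by (simp add: t)
    show "nn0 \<A> a \<cdot>\<^bsub>?A\<^esub> FArr t0 \<psi> \<in> hom ?A (FObj t0 (FObj d1 a)) a"
      "nn1 \<A> a \<in> hom ?A (FObj t0 (FObj d1 a)) a"
      by (auto intro!: homI simp: t)
  qed
  ultimately show ?thesis
    using a \<psi> unfolding lax_descent_data_def folds by simp
qed


section \<open>Descent and monadicity\<close>

text \<open>Any functor that is equivalent to the forgetful functor of a lax descent category is monadic as
  soon as it has a left adjoint; kernel pairs enter only when this is applied to \<open>\<F>\<^sup>p\<close>.\<close>

theorem monadic_of_lax_descent_equivalence: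
  assumes \<A>: "pseudofunctor Delta3 \<A>"
    and R: "is_functor B (PCat \<A> 1) R"
    and K: "equivalence_of_cats B (lax_Desc \<A>) K"
    and K_Obj: "\<And>x. x \<in> Obj B \<Longrightarrow> FObj K x = (FObj R x, \<theta> x)"
    and K_Arr: "\<And>u. u \<in> Arr B \<Longrightarrow> fst (snd (FArr K u)) = FArr R u"
    and L: "has_left_adjoint B (PCat \<A> 1) R"
  shows "monadic B (PCat \<A> 1) R"
proof -
  have "inserter_equivalence (PCat \<A> 1) (PCat \<A> 2) (PFun \<A> (dd 1)) (PFun \<A> (dd 0)) (lax_descent_data \<A>) B R K \<theta>"
  proof
    show "is_functor (PCat \<A> 1) (PCat \<A> 2) (PFun \<A> (dd 1))" "is_functor (PCat \<A> 1) (PCat \<A> 2) (PFun \<A> (dd 0))"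
      by (rule pseudofunctorD(3)[OF \<A>] Delta3_generators_hom)+
    show "lax_descent_data \<A> \<subseteq> inserter_objects (PCat \<A> 1) (PCat \<A> 2) (PFun \<A> (dd 1)) (PFun \<A> (dd 0))"
      by (auto simp: lax_descent_data_def inserter_objects_def)
  qed (use lax_descent_data_split_quotient[OF \<A>] R K K_Obj K_Arr in \<open>auto simp: lax_Desc_eq_full_inserter\<close>)
  then show ?thesis using L by (rule inserter_equivalence.monadic_of_inserter_equivalence)
qed

theorem theorem4p6:
  fixes C :: "('c, 'k) cat" and \<F> :: "('c, 'k, 'o, 'm) pfunc" and p :: 'k and e b :: 'c
  assumes "category C" and "has_pullbacks C"
    and "pseudofunctor (op_cat C) \<F>"
    and "p \<in> hom C e b"
    and "effective_descent C \<F> p"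
    and "has_left_adjoint (PCat \<F> b) (PCat \<F> e) (PFun \<F> p)"
  shows "monadic (PCat \<F> b) (PCat \<F> e) (PFun \<F> p)"
proof -
  have p: "p \<in> Arr C" "Dom C p = e" "Cod C p = b" using homD[OF assms(4)] by simp_all
  obtain P pr where fp: "fibre_powers C p P pr"
    and K: "equivalence_of_cats (PCat \<F> b) (lax_Desc (F_p C \<F> P pr)) (descent_comparison C \<F> p P pr)"
    using assms(5) unfolding effective_descent_def p by blast
  have \<A>1: "PCat (F_p C \<F> P pr) 1 = PCat \<F> e"
    using fp p by (simp add: F_p_def pf_precomp_def Eq_def fibre_powers_def)
  have R: "is_functor (PCat \<F> b) (PCat \<F> e) (PFun \<F> p)"
    by (rule pseudofunctorD(3)[OF assms(3)]) (simp add: hom_def op_cat_def p)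
  show ?thesis
    using monadic_of_lax_descent_equivalence[OF F_p_pseudofunctor[OF assms(1) p(1) fp assms(3)], unfolded \<A>1,
        OF R K _ _ assms(6)]
    by (simp add: descent_comparison_def Let_def)
qed

end
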